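(* For every positive integer $q$ and every vector $\mathbf a=(a_1,\dots,a_q)$ with $a_i>0$ ($i\in[q]$) and $\sum_{i=1}^q a_i=1$, the minimum weighted $\mathbf a$-balanced $q$-way cut density $$\mu_q^{\mathbf a}(G)=\min_{(V_1,\dots,V_q)\in\mathcal P_q^{\mathbf a}}\sum_{i=1}^{q-1}\sum_{j=i+1}^q\frac1{\alpha_{V_i}\alpha_{V_j}}\,e_G(V_i,V_j)$$ is a testable weighted graph parameter.
   Context: $\mathcal G$ is the set of all finite weighted graphs $G$ on vertex sets $V(G)=[n]=\{1,\dots,n\}$ with vertex-weights $\alpha_i=\alpha_i(G)>0$ and edge-weights $\beta_{ij}=\beta_{ji}\in[0,1]$ ($i,j\in[n]$). Put $\alpha_G=\sum_i\alpha_i$, $\alpha_T=\sum_{i\in T}\alpha_i$ for $T\subset V(G)$, $\alpha_{\max}(G)=\max_i\alpha_i$, and $e_G(S,T)=\sum_{s\in S}\sum_{t\in T}\alpha_s\alpha_t\beta_{st}$. Simple graphs are regarded as elements of $\mathcal G$ with all vertex-weights $1$ and edge-weights $0$ or $1$ (no loops). $\mathcal P_q^{\mathbf a}$ is the set of partitions $(V_1,\dots,V_q)$ of $V(G)$ into $q$ non-empty disjoint sets such that $|\alpha_{V_i}/\alpha_G-a_i|\le\alpha_{\max}(G)/\alpha_G$ for $i=1,\dots,q$. Random sample: $\xi(k,G)$ is the random simple graph on vertex set $[k]$ obtained by choosing $k$ vertices $\Phi(1),\dots,\Phi(k)$ of $G$ independently, with replacement, each equal to $i$ with probability $\alpha_i/\alpha_G$,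 and then, given these, joining each pair $u\neq v$ in $[k]$ by an edge conditionally independently with probability $\beta_{\Phi(u)\Phi(v)}$. Testability: an isomorphism-invariant real-valued function $f$ of weighted graphs is testable if for every $\varepsilon>0$ there is a positive integer $k$ such that every $G\in\mathcal G$ with $\max_i\alpha_i(G)/\alpha_G\le1/k$ satisfies $\mathbb P(|f(G)-f(\xi(k,G))|>\varepsilon)\le\varepsilon$. If $f$ is given by a minimum over a set of partitions that may be empty for some graphs, $k$ is required to be such that $f$ is defined (that set is non-empty) for every $G\in\mathcal G$ with $\max_i\alpha_i(G)/\alpha_G\le1/k$; this includes every simple graph on $k$ vertices. *)

theory Defs
  imports "HOL-Probability.Probability" "HOL-Probability.Product_PMF"
begin

section \<open>Weighted graphs\<close>

record wgraph =
  nverts :: nat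
  vweight :: "nat \<Rightarrow> real"
  eweight :: "nat \<Rightarrow> nat \<Rightarrow> real"

definition verts :: "wgraph \<Rightarrow> nat set" where
  "verts G = {1..nverts G}"

text \<open>The weight functions are unconstrained outside the vertex set. Graphs are non-empty, so that
  the total weight is positive and the maximal vertex-weight exists. Loops of any weight in
  the unit interval are allowed.\<close>

definition weighted_graphs :: "wgraph set" where
  "weighted_graphs = {G. nverts G \<ge> 1
     \<and> (\<forall>i\<in>verts G. vweight G i > 0)
     \<and> (\<forall>i\<in>verts G. \<forall>j\<in>verts G.
          0 \<le> eweight G i j \<and> eweight G i j \<le> 1 \<and> eweight G i j = eweight G j i)}"

definition weight :: "wgraph \<Rightarrow> nat set \<Rightarrow> real" where
  "weight G T = (\<Sum>i\<in>T. vweight G i)"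

definition total_weight :: "wgraph \<Rightarrow> real" where
  "total_weight G = weight G (verts G)"

definition max_weight :: "wgraph \<Rightarrow> real" where
  "max_weight G = Max (vweight G ` verts G)"

definition edge_mass :: "wgraph \<Rightarrow> nat set \<Rightarrow> nat set \<Rightarrow> real" where
  "edge_mass G S T = (\<Sum>s\<in>S. \<Sum>t\<in>T. vweight G s * vweight G t * eweight G s t)"

definition isomorphic :: "wgraph \<Rightarrow> wgraph \<Rightarrow> bool" where
  "isomorphic G H \<longleftrightarrow> (\<exists>p. bij_betw p (verts G) (verts H)
     \<and> (\<forall>i\<in>verts G. vweight H (p i) = vweight G i)
     \<and> (\<forall>i\<in>verts G. \<forall>j\<in>verts G. eweight H (p i) (p j) = eweight G i j))"

section \<open>Random sampling\<close>

text \<open>Only the values \<open>E (u, v)\<close> with \<open>u < v\<close> matter: they say whether the unordered pair is an edge.\<close>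

definition simple_graph :: "nat \<Rightarrow> (nat \<times> nat \<Rightarrow> bool) \<Rightarrow> wgraph" where
  "simple_graph k E = \<lparr>nverts = k, vweight = (\<lambda>_. 1),
     eweight = (\<lambda>u v. of_bool (u < v \<and> E (u, v) \<or> v < u \<and> E (v, u)))\<rparr>"

definition random_vertex :: "wgraph \<Rightarrow> nat pmf" where
  "random_vertex G =
     embed_pmf (\<lambda>i. if i \<in> verts G then vweight G i / total_weight G else 0)"

definition sample :: "nat \<Rightarrow> wgraph \<Rightarrow> wgraph pmf" where
  "sample k G =
     bind_pmf (Pi_pmf {1..k} 0 (\<lambda>_. random_vertex G)) (\<lambda>\<Phi>.
       map_pmf (simple_graph k)
         (Pi_pmf {(u, v). 1 \<le> u \<and> u < v \<and> v \<le> k} False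
            (\<lambda>(u, v). bernoulli_pmf (eweight G (\<Phi> u) (\<Phi> v)))))"

lemma pmf_random_vertex:
  assumes "G \<in> weighted_graphs"
  shows "pmf (random_vertex G) i =
    (if i \<in> verts G then vweight G i / total_weight G else 0)"
proof -
  let ?f = "\<lambda>i. if i \<in> verts G then vweight G i / total_weight G else 0"
  have pos: "\<And>i. i \<in> verts G \<Longrightarrow> vweight G i > 0"
    and fin: "finite (verts G)" and ne: "verts G \<noteq> {}"
    using assms by (auto simp: weighted_graphs_def verts_def)
  have tot: "total_weight G > 0"
    unfolding total_weight_def weight_def by (intro sum_pos fin ne pos)
  have nn: "?f i \<ge> 0" for i
    using pos tot by (auto intro!: divide_nonneg_pos less_imp_le)
  have "(\<integral>\<^sup>+ i. ennreal (?f i) \<partial>count_space UNIV)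
        = (\<integral>\<^sup>+ i. ennreal (?f i) \<partial>count_space (verts G))"
    by (subst nn_integral_count_space_indicator)
       (auto intro!: nn_integral_cong simp: indicator_def)
  also have "\<dots> = (\<Sum>i\<in>verts G. ennreal (?f i))"
    using fin by (simp add: nn_integral_count_space_finite)
  also have "\<dots> = ennreal (\<Sum>i\<in>verts G. ?f i)"
    by (rule sum_ennreal) (rule nn)
  also have "(\<Sum>i\<in>verts G. ?f i) = (\<Sum>i\<in>verts G. vweight G i) / total_weight G"
    by (simp add: sum_divide_distrib)
  also have "\<dots> = 1"
    using tot by (simp add: total_weight_def weight_def)
  finally have "(\<integral>\<^sup>+ i. ennreal (?f i) \<partial>count_space UNIV) = 1"
    by simp
  then show ?thesis
    unfolding random_vertex_def by (intro pmf_embed_pmf) (use nn in auto)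
qed

lemma simple_graph_in_weighted_graphs:
  "k \<ge> 1 \<Longrightarrow> simple_graph k E \<in> weighted_graphs"
  by (auto simp: simple_graph_def weighted_graphs_def)

lemma max_weight_ratio_simple_graph:
  "k \<ge> 1 \<Longrightarrow> max_weight (simple_graph k E) / total_weight (simple_graph k E) = 1 / k"
  by (simp add: simple_graph_def max_weight_def total_weight_def weight_def verts_def)

section \<open>Testable parameters\<close>

text \<open>A parameter that is undefined for some graphs has the value \<open>None\<close> there. In the definition of
  testability, \<open>f G \<noteq> None\<close> for all graphs \<open>G\<close> in the given range covers the sampled graphs as well,
  since simple graphs on \<open>k\<close> vertices are in that range (\<open>max_weight_ratio_simple_graph\<close>).\<close>

definition isomorphism_invariant :: "(wgraph \<Rightarrow> real option) \<Rightarrow> bool" where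
  "isomorphism_invariant f \<longleftrightarrow>
     (\<forall>G\<in>weighted_graphs. \<forall>H\<in>weighted_graphs. isomorphic G H \<longrightarrow> f G = f H)"

definition testable :: "(wgraph \<Rightarrow> real option) \<Rightarrow> bool" where
  "testable f \<longleftrightarrow> isomorphism_invariant f \<and>
     (\<forall>\<epsilon>>0. \<exists>k\<ge>1. \<forall>G\<in>weighted_graphs. max_weight G / total_weight G \<le> 1 / real k \<longrightarrow>
        f G \<noteq> None \<and>
        measure_pmf.prob (sample k G) {H. \<bar>the (f G) - the (f H)\<bar> > \<epsilon>} \<le> \<epsilon>)"

section \<open>Balanced multiway cuts\<close>

text \<open>A \<open>q\<close>-tuple of vertex sets is an extensional function on \<open>{1..q}\<close>, so there are only finitely
  many and the minimum below is over a finite set.\<close>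

definition balanced_partitions :: "nat \<Rightarrow> (nat \<Rightarrow> real) \<Rightarrow> wgraph \<Rightarrow> (nat \<Rightarrow> nat set) set" where
  "balanced_partitions q a G = {V \<in> {1..q} \<rightarrow>\<^sub>E Pow (verts G).
     (\<forall>i\<in>{1..q}. V i \<noteq> {}) \<and> disjoint_family_on V {1..q} \<and> (\<Union>i\<in>{1..q}. V i) = verts G
     \<and> (\<forall>i\<in>{1..q}. \<bar>weight G (V i) / total_weight G - a i\<bar> \<le> max_weight G / total_weight G)}"

definition weighted_cut_density :: "nat \<Rightarrow> wgraph \<Rightarrow> (nat \<Rightarrow> nat set) \<Rightarrow> real" where
  "weighted_cut_density q G V =
     (\<Sum>i=1..q-1. \<Sum>j=i+1..q.
        1 / (weight G (V i) * weight G (V j)) * edge_mass G (V i) (V j))"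

definition min_cut_density :: "nat \<Rightarrow> (nat \<Rightarrow> real) \<Rightarrow> wgraph \<Rightarrow> real option" where
  "min_cut_density q a G =
     (if balanced_partitions q a G = {} then None
      else Some (Min (weighted_cut_density q G ` balanced_partitions q a G)))"

lemma finite_balanced_partitions: "finite (balanced_partitions q a G)"
  by (rule finite_subset[of _ "{1..q} \<rightarrow>\<^sub>E Pow (verts G)"])
     (auto simp: balanced_partitions_def verts_def intro!: finite_PiE)

end

theory Submission
  imports Defs
begin

text \<open>Normalise the vertex weights to a probability vector. By weak regularity the edge weights of \<open>G\<close>
  are close to a step kernel \<open>\<kappa> (\<tau> x) (\<tau> y)\<close> with boundedly many types, closeness being measured by the
  density of 4-cycles of the (signed) difference. This density dominates the fourth power of the cut norm, and
  its expectation for a random sample equals the density for \<open>G\<close> up to \<open>6 / k\<close>, because four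
  distinct sampled vertices see independent edges. So by Markov's inequality the sample is close in cut
  norm to the same step kernel, pulled back along the sampled vertices, and by a second moment bound the masses of the types
  agree as well. The two graphs then play symmetric roles: a balanced partition of one is described up
  to a small error by how much of each type goes to each class, and such a description can be realised
  in the other graph by exactly balanced classes.\<close>

section \<open>Rounding fractional partitions\<close>

text \<open>The minimum runs over exponentially many partitions, so errors must be controlled for
  all vertex sets at once, which is what the cut norm does. For the sample it is a supremum over
  \<open>4^k\<close> pairs of sets inside an expectation; the 4-cycle density is a polynomial, whose
  expectation is computed term by term. For kernels with values in \<open>[-1, 1]\<close> it is also
  at most four times the cut norm, so the detour loses only a power; this is why the step kernel has
  to stay in \<open>[0, 1]\<close>. The other obstacle is the balance condition. The tolerance of
  each graph is its own maximal vertex weight ratio: it is \<open>1/k\<close> for the sample but can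
  be far smaller for \<open>G\<close>. A partition moved from one graph to the other must therefore
  be repaired to within one largest vertex of the target, while its distribution over the types
  hardly changes. All \<open>a i\<close> are positive, so class weights stay above a fixed constant
  and the quotients are stable. Constants are chosen in the order cut error, 4-cycle error, number
  of types, mass error, \<open>k\<close>, independently of \<open>G\<close>.\<close>

lemma sum_UN_le:
  fixes p :: "'a \<Rightarrow> real"
  assumes "finite I" "\<And>i. i \<in> I \<Longrightarrow> finite (D i)" "\<And>i v. i \<in> I \<Longrightarrow> v \<in> D i \<Longrightarrow> 0 \<le> p v"
  shows "sum p (\<Union>i\<in>I. D i) \<le> (\<Sum>i\<in>I. sum p (D i))"
  using assms
proof (induction I rule: finite_induct)
  case (insert j I)
  have fin: "finite (\<Union>i\<in>I. D i)" "finite (D j)" using insert by auto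
  have "sum p (\<Union>i\<in>insert j I. D i) = sum p (D j) + sum p ((\<Union>i\<in>I. D i) - D j)"
    by (subst sum.union_disjoint[symmetric]) (use fin in \<open>auto intro!: sum.cong\<close>)
  also have "\<dots> \<le> sum p (D j) + sum p (\<Union>i\<in>I. D i)"
    using insert by (intro add_mono sum_mono2) (use fin in auto)
  also have "\<dots> \<le> sum p (D j) + (\<Sum>i\<in>I. sum p (D i))"
    using insert by auto
  finally show ?case using insert by simp
qed simp

text \<open>\<open>X\<close> is ordered by \<open>(g v, v)\<close> and cut at the partial sums of \<open>b\<close>. For each \<open>i\<close> the sets \<open>{f \<le> i}\<close> and
  \<open>{g \<le> i}\<close> are both initial segments, hence nested, so \<open>f\<close> stays close to \<open>g\<close>.\<close>

lemma interval_rounding: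
  fixes p b :: "nat \<Rightarrow> real" and g :: "nat \<Rightarrow> nat"
  assumes fin: "finite X" and pos: "\<And>v. v \<in> X \<Longrightarrow> 0 < p v" and small: "\<And>v. v \<in> X \<Longrightarrow> p v \<le> \<rho>"
    and rho: "0 \<le> \<rho>" and g: "\<And>v. v \<in> X \<Longrightarrow> g v \<in> {1..q}"
    and b: "\<And>i. i \<in> {1..q} \<Longrightarrow> 0 \<le> b i" and tot: "(\<Sum>i=1..q. b i) = sum p X"
  obtains f where "\<forall>v\<in>X. f v \<in> {1..q}"
    and "\<forall>i\<in>{1..q}. \<bar>sum p {v\<in>X. f v = i} - b i\<bar> \<le> \<rho>"
    and "sum p {v\<in>X. f v \<noteq> g v} \<le> q * ((\<Sum>j=1..q. \<bar>b j - sum p {v\<in>X. g v = j}\<bar>) + \<rho>)"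
proof -
  define N where "N = Suc (Max X)"
  have ltN: "v < N" if "v \<in> X" for v using fin that by (simp add: N_def less_Suc_eq_le)
  \<comment> \<open>Since \<open>v < N\<close> on \<open>X\<close>, this encodes the lexicographic
    order of \<open>(g v, v)\<close> injectively in the natural numbers.\<close>
  define r where "r v = g v * N + v" for v
  have r_mono: "r u < r v" if "g u < g v" "u \<in> X" for u v
  proof -
    have "r u < (g u + 1) * N" using ltN[OF that(2)] by (simp add: r_def)
    also have "\<dots> \<le> g v * N" using that by (intro mult_right_mono) auto
    finally show ?thesis by (simp add: r_def)
  qed
  have r_inj: "u = v" if "r u = r v" "u \<in> X" "v \<in> X" for u v
    using that r_mono[of u v] r_mono[of v u] by (cases "g u" "g v" rule: linorder_cases) (auto simp: r_def)
  \<comment> \<open>\<open>S v\<close> counts \<open>v\<close> itself: with \<open>X\<close> laid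
    out as consecutive intervals along \<open>[0, sum p X]\<close>, it is the right end of the
    interval of \<open>v\<close>, and \<open>f v\<close> will name the target block containing this
    end.\<close>
  define S where "S v = sum p {u\<in>X. r u \<le> r v}" for v
  define A where "A i = (\<Sum>j=1..i. b j)" for i
  define L where "L i = {v\<in>X. S v \<le> A i}" for i
  define f where "f v = (LEAST i. S v \<le> A i)" for v
  have A_mono: "A i \<le> A j" if "i \<le> j" "j \<le> q" for i j
    unfolding A_def by (intro sum_mono2) (use that b in auto)
  have Aq: "A q = sum p X" using tot by (simp add: A_def)
  have S_le: "S v \<le> A q" for v
    unfolding S_def Aq by (intro sum_mono2) (use fin pos in \<open>auto intro: less_imp_le\<close>)
  have S_pos: "0 < S v" if "v \<in> X" for v
    unfolding S_def by (intro sum_pos) (use fin pos that in auto)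
  have f_le: "f v \<le> i \<longleftrightarrow> S v \<le> A i" if "i \<le> q" for v i
  proof
    assume "f v \<le> i"
    moreover have "S v \<le> A (f v)" unfolding f_def by (rule LeastI[of _ q]) (rule S_le)
    ultimately show "S v \<le> A i" using A_mono[of "f v" i] that by simp
  qed (simp add: f_def Least_le)
  have f_range: "f v \<in> {1..q}" if "v \<in> X" for v
    using f_le[of q v] f_le[of 0 v] S_le[of v] S_pos[OF that] by (simp add: A_def Suc_le_eq)
  have L_f: "L i = {v\<in>X. f v \<le> i}" if "i \<le> q" for i using f_le[OF that] by (auto simp: L_def)
  have S_mono: "S u \<le> S v" if "r u \<le> r v" for u v
    unfolding S_def by (intro sum_mono2) (use fin pos that in \<open>auto intro: less_imp_le\<close>)
  have finL: "finite (L i)" for i using fin by (simp add: L_def)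
  \<comment> \<open>Because right ends decide, \<open>L i\<close> never exceeds \<open>A i\<close>
    and falls short of it by at most one vertex. Both errors have the same sign, so differences of
    consecutive \<open>L i\<close> err by \<open>\<rho>\<close> and not by
    \<open>2 * \<rho>\<close>.\<close>
  have L_upper: "sum p (L i) \<le> A i" if "i \<le> q" for i
  proof (cases "L i = {}")
    case True then show ?thesis using b that by (auto simp: A_def intro!: sum_nonneg)
  next
    case False
    then have "Max (r ` L i) \<in> r ` L i" using finL by (intro Max_in) auto
    then obtain m where "m \<in> L i" "Max (r ` L i) = r m" by auto
    then have m: "m \<in> L i" "\<And>u. u \<in> L i \<Longrightarrow> r u \<le> r m"
      using finL[of i] Max_ge[of "r ` L i"] by auto
    have "sum p (L i) \<le> S m"
      unfolding S_def by (intro sum_mono2) (use fin pos m(2) in \<open>auto simp: L_def intro: less_imp_le\<close>)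
    then show ?thesis using m(1) by (simp add: L_def)
  qed
  have L_lower: "A i - \<rho> \<le> sum p (L i)" if "i \<le> q" for i
  proof (cases "L i = X")
    case True then show ?thesis using A_mono[OF that] Aq rho by simp
  next
    case False
    then have ne: "X - L i \<noteq> {}" by (auto simp: L_def)
    have finD: "finite (X - L i)" using fin by simp
    with ne have "Min (r ` (X - L i)) \<in> r ` (X - L i)" by (intro Min_in) auto
    then obtain m where "m \<in> X - L i" "Min (r ` (X - L i)) = r m" by auto
    then have m: "m \<in> X - L i" "\<And>u. u \<in> X - L i \<Longrightarrow> r m \<le> r u"
      using finD Min_le[of "r ` (X - L i)"] by auto
    have "{u\<in>X. r u \<le> r m} \<subseteq> insert m (L i)"
    proof
      fix u assume u: "u \<in> {u\<in>X. r u \<le> r m}"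
      show "u \<in> insert m (L i)"
      proof (cases "u \<in> L i")
        case False
        then have "r u = r m" using m(2)[of u] u by simp
        then show ?thesis using r_inj[of u m] u m(1) by simp
      qed simp
    qed
    then have "S m \<le> sum p (insert m (L i))"
      unfolding S_def using finL pos m(1) by (intro sum_mono2) (auto simp: L_def intro: less_imp_le)
    also have "\<dots> = p m + sum p (L i)" using m(1) finL by (intro sum.insert) auto
    finally have "S m \<le> p m + sum p (L i)" .
    moreover have "S m > A i" using m(1) by (auto simp: L_def)
    moreover have "p m \<le> \<rho>" using m(1) small by simp
    ultimately show ?thesis by linarith
  qed
  have part: "\<bar>sum p {v\<in>X. f v = i} - b i\<bar> \<le> \<rho>" if i: "i \<in> {1..q}" for i
  proof -
    have "sum p (L i) = sum p (L (i - 1)) + sum p {v\<in>X. f v = i}"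
      using i fin by (subst sum.union_disjoint[symmetric])
        (auto simp: L_f intro!: sum.cong)
    moreover have "A i = A (i - 1) + b i" using i by (cases i) (auto simp: A_def)
    moreover have "i \<le> q" "i - 1 \<le> q" using i by auto
    ultimately show ?thesis
      using L_upper[of i] L_lower[of i] L_upper[of "i - 1"] L_lower[of "i - 1"]
      unfolding abs_le_iff by linarith
  qed
  define D where "D = (\<Sum>j=1..q. \<bar>b j - sum p {v\<in>X. g v = j}\<bar>)"
  define G where "G i = {v\<in>X. g v \<le> i}" for i
  have sym: "sum p {v\<in>X. (f v \<le> i) \<noteq> (g v \<le> i)} \<le> D + \<rho>" if i: "i \<in> {1..q}" for i
  proof -
    have G: "sum p (G i) = (\<Sum>j=1..i. sum p {v\<in>X. g v = j})"
    proof -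
      have "G i = (\<Union>j\<in>{1..i}. {v\<in>X. g v = j})" using g by (auto simp: G_def)
      then show ?thesis using fin by (simp only:) (rule sum.UNION_disjoint, auto)
    qed
    have "\<bar>A i - sum p (G i)\<bar> \<le> (\<Sum>j=1..i. \<bar>b j - sum p {v\<in>X. g v = j}\<bar>)"
      unfolding G A_def sum_subtractf[symmetric] by (rule sum_abs)
    also have "\<dots> \<le> D" unfolding D_def using i by (intro sum_mono2) auto
    finally have AG: "\<bar>A i - sum p (G i)\<bar> \<le> D" .
    have diff: "sum p {v\<in>X. (f v \<le> i) \<noteq> (g v \<le> i)} = \<bar>sum p (L i) - sum p (G i)\<bar>"
    proof (cases "L i \<subseteq> G i")
      case True
      then have "{v\<in>X. (f v \<le> i) \<noteq> (g v \<le> i)} = G i - L i" using i by (auto simp: L_f G_def)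
      moreover have "sum p (G i - L i) = sum p (G i) - sum p (L i)"
        using True fin by (intro sum_diff) (auto simp: G_def)
      moreover have "sum p (L i) \<le> sum p (G i)"
        using True fin pos by (intro sum_mono2) (auto simp: G_def intro: less_imp_le)
      ultimately show ?thesis by simp
    next
      case False
      then obtain v where v: "v \<in> X" "f v \<le> i" "i < g v"
        using i by (auto simp: L_f G_def subset_iff not_le)
      \<comment> \<open>Every element of \<open>G i\<close> precedes \<open>v\<close> in the order,
        as \<open>g v > i\<close>, and so inherits the bound \<open>S v \<le> A i\<close>.\<close>
      have "f u \<le> i" if "u \<in> G i" for u
      proof -
        have "r u \<le> r v" using r_mono[of u v] v that by (auto simp: G_def)
        then show ?thesis using S_mono f_le[of i] v i by (meson atLeastAtMost_iff order_trans)
      qed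
      then have sub: "G i \<subseteq> L i" using i by (auto simp: L_f G_def)
      then have "{v\<in>X. (f v \<le> i) \<noteq> (g v \<le> i)} = L i - G i" using i by (auto simp: L_f G_def)
      moreover have "sum p (L i - G i) = sum p (L i) - sum p (G i)"
        using sub fin by (intro sum_diff) (auto simp: L_def)
      moreover have "sum p (G i) \<le> sum p (L i)"
        using sub fin pos by (intro sum_mono2) (auto simp: L_def intro: less_imp_le)
      ultimately show ?thesis by simp
    qed
    then show ?thesis using AG L_upper[of i] L_lower[of i] i by auto
  qed
  \<comment> \<open>Where \<open>f\<close> and \<open>g\<close> differ, the threshold
    \<open>min (f v) (g v)\<close> separates them; the union over \<open>q\<close> thresholds is the
    source of the factor \<open>q\<close>.\<close>
  have "sum p {v\<in>X. f v \<noteq> g v} \<le> sum p (\<Union>i\<in>{1..q}. {v\<in>X. (f v \<le> i) \<noteq> (g v \<le> i)})"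
  proof (intro sum_mono2)
    show "{v\<in>X. f v \<noteq> g v} \<subseteq> (\<Union>i\<in>{1..q}. {v\<in>X. (f v \<le> i) \<noteq> (g v \<le> i)})"
    proof
      fix v assume v: "v \<in> {v\<in>X. f v \<noteq> g v}"
      then have "min (f v) (g v) \<in> {1..q}" using f_range[of v] g[of v] by auto
      moreover have "(f v \<le> min (f v) (g v)) \<noteq> (g v \<le> min (f v) (g v))" using v by auto
      ultimately show "v \<in> (\<Union>i\<in>{1..q}. {v\<in>X. (f v \<le> i) \<noteq> (g v \<le> i)})" using v by blast
    qed
  qed (use fin pos in \<open>auto intro: less_imp_le\<close>)
  also have "\<dots> \<le> (\<Sum>i=1..q. sum p {v\<in>X. (f v \<le> i) \<noteq> (g v \<le> i)})"
    by (intro sum_UN_le) (use fin pos in \<open>auto intro: less_imp_le\<close>)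
  also have "\<dots> \<le> (\<Sum>i=1..q. D + \<rho>)" by (intro sum_mono sym) auto
  also have "\<dots> = q * (D + \<rho>)" by simp
  finally have "sum p {v\<in>X. f v \<noteq> g v} \<le> q * (D + \<rho>)" .
  moreover have "\<forall>v\<in>X. f v \<in> {1..q}" "\<forall>i\<in>{1..q}. \<bar>sum p {v\<in>X. f v = i} - b i\<bar> \<le> \<rho>"
    using f_range part by blast+
  ultimately show thesis unfolding D_def by (intro that)
qed

section \<open>Cut sums and 4-cycle densities\<close>

definition prob_weights :: "nat set \<Rightarrow> (nat \<Rightarrow> real) \<Rightarrow> bool" where
  "prob_weights V p \<longleftrightarrow> finite V \<and> (\<forall>v\<in>V. 0 < p v) \<and> sum p V = 1"

definition cut_sum :: "(nat \<Rightarrow> real) \<Rightarrow> (nat \<Rightarrow> nat \<Rightarrow> real) \<Rightarrow> nat set \<Rightarrow> nat set \<Rightarrow> real" where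
  "cut_sum p U S T = (\<Sum>s\<in>S. \<Sum>t\<in>T. p s * p t * U s t)"

text \<open>Weighted density of 4-cycles \<open>x y x' y'\<close>, the fourth power of the box norm of \<open>U\<close>.\<close>

definition c4 :: "nat set \<Rightarrow> (nat \<Rightarrow> real) \<Rightarrow> (nat \<Rightarrow> nat \<Rightarrow> real) \<Rightarrow> real" where
  "c4 V p U = (\<Sum>y\<in>V. \<Sum>y'\<in>V. \<Sum>x\<in>V. \<Sum>x'\<in>V.
     p x * p x' * p y * p y' * (U x y * U x' y * U x y' * U x' y'))"

text \<open>Nonnegativity of the variance of \<open>z\<close> under \<open>p\<close>; the form of
  Cauchy-Schwarz used below.\<close>

lemma weighted_mean_square_le:
  assumes "prob_weights V p"
  shows "(\<Sum>v\<in>V. p v * z v)\<^sup>2 \<le> (\<Sum>v\<in>V. p v * (z v)\<^sup>2)"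
proof -
  define m where "m = (\<Sum>v\<in>V. p v * z v)"
  have "0 \<le> (\<Sum>v\<in>V. p v * (z v - m)\<^sup>2)"
    using assms by (intro sum_nonneg) (auto simp: prob_weights_def intro!: mult_nonneg_nonneg intro: less_imp_le)
  also have "\<dots> = (\<Sum>v\<in>V. p v * (z v)\<^sup>2 - 2 * m * (p v * z v) + m\<^sup>2 * p v)"
    by (intro sum.cong) (auto simp: power2_eq_square algebra_simps)
  also have "\<dots> = (\<Sum>v\<in>V. p v * (z v)\<^sup>2) - 2 * m * m + m\<^sup>2 * 1"
    using assms by (simp add: sum.distrib sum_subtractf sum_distrib_left[symmetric] m_def prob_weights_def)
  finally show ?thesis by (simp add: m_def power2_eq_square)
qed

text \<open>For fixed \<open>y\<close> and \<open>y'\<close> the sums over \<open>x\<close> and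
  \<open>x'\<close> factor into the same inner product, so the density is an average of squares.
  This shows its sign and is the form that Cauchy-Schwarz produces.\<close>

lemma c4_eq:
  "c4 V p U = (\<Sum>y\<in>V. p y * (\<Sum>y'\<in>V. p y' * (\<Sum>x\<in>V. p x * (U x y * U x y'))\<^sup>2))"
proof -
  have "c4 V p U = (\<Sum>y\<in>V. \<Sum>y'\<in>V. \<Sum>x\<in>V. \<Sum>x'\<in>V.
     p x * p x' * p y * p y' * (U x y * U x' y * U x y' * U x' y'))"
    by (simp add: c4_def)
  also have "\<dots> = (\<Sum>y\<in>V. \<Sum>y'\<in>V. p y * p y' * ((\<Sum>x\<in>V. p x * (U x y * U x y')) * (\<Sum>x'\<in>V. p x' * (U x' y * U x' y'))))"
    unfolding sum_product by (simp add: sum_distrib_left mult_ac)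
  also have "\<dots> = (\<Sum>y\<in>V. p y * (\<Sum>y'\<in>V. p y' * (\<Sum>x\<in>V. p x * (U x y * U x y'))\<^sup>2))"
    by (simp add: sum_distrib_left power2_eq_square mult_ac)
  finally show ?thesis .
qed

text \<open>Squaring under the average over \<open>x\<close> removes the constraint
  \<open>x \<in> S\<close> and creates two copies \<open>y\<close>, \<open>y'\<close> of the second
  variable; squaring again, over \<open>y\<close> and then over \<open>y'\<close>, removes
  \<open>T\<close> from both copies.\<close>

lemma cut_sum_le_c4:
  assumes V: "prob_weights V p" and sub: "S \<subseteq> V" "T \<subseteq> V"
  shows "(cut_sum p U S T) ^ 4 \<le> c4 V p U"
proof -
  have fin: "finite V" and pos: "\<And>v. v \<in> V \<Longrightarrow> 0 \<le> p v" using V by (auto simp: prob_weights_def intro: less_imp_le)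
  define F where "F x = (\<Sum>y\<in>V. p y * (of_bool (y \<in> T) * U x y))" for x
  define Q where "Q y y' = (\<Sum>x\<in>V. p x * (U x y * U x y'))" for y y'
  define R where "R y = (\<Sum>y'\<in>V. p y' * (of_bool (y' \<in> T) * Q y y'))" for y
  have F: "F x = (\<Sum>y\<in>T. p y * U x y)" for x
    unfolding F_def by (rule sum.mono_neutral_cong_right) (use fin sub in auto)
  have "cut_sum p U S T = (\<Sum>x\<in>S. p x * F x)"
    by (simp add: cut_sum_def F sum_distrib_left mult_ac)
  also have "\<dots> = (\<Sum>x\<in>V. p x * (of_bool (x \<in> S) * F x))"
    by (rule sum.mono_neutral_cong_left) (use fin sub in auto)
  finally have c: "cut_sum p U S T = \<dots>" .
  have "(cut_sum p U S T)\<^sup>2 \<le> (\<Sum>x\<in>V. p x * (of_bool (x \<in> S) * F x)\<^sup>2)"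
    unfolding c by (rule weighted_mean_square_le[OF V])
  also have "\<dots> \<le> (\<Sum>x\<in>V. p x * (F x)\<^sup>2)"
    by (intro sum_mono mult_left_mono pos) auto
  also have "\<dots> = (\<Sum>x\<in>V. \<Sum>y\<in>V. \<Sum>y'\<in>V. p x * (p y * (of_bool (y \<in> T) * U x y)) * (p y' * (of_bool (y' \<in> T) * U x y')))"
    unfolding F_def power2_eq_square sum_product by (simp add: sum_distrib_left mult.assoc)
  also have "\<dots> = (\<Sum>y\<in>V. \<Sum>y'\<in>V. \<Sum>x\<in>V. p x * (p y * (of_bool (y \<in> T) * U x y)) * (p y' * (of_bool (y' \<in> T) * U x y')))"
    by (subst sum.swap, rule sum.cong[OF refl], rule sum.swap)
  also have "\<dots> = (\<Sum>y\<in>V. p y * (of_bool (y \<in> T) * R y))"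
    by (simp add: R_def Q_def sum_distrib_left mult_ac)
  finally have 1: "(cut_sum p U S T)\<^sup>2 \<le> (\<Sum>y\<in>V. p y * (of_bool (y \<in> T) * R y))" .
  have "(cut_sum p U S T) ^ 4 = ((cut_sum p U S T)\<^sup>2)\<^sup>2" by simp
  also have "\<dots> \<le> (\<Sum>y\<in>V. p y * (of_bool (y \<in> T) * R y))\<^sup>2"
    using 1 by (intro power_mono) auto
  also have "\<dots> \<le> (\<Sum>y\<in>V. p y * (of_bool (y \<in> T) * R y)\<^sup>2)"
    by (rule weighted_mean_square_le[OF V])
  also have "\<dots> \<le> (\<Sum>y\<in>V. p y * (\<Sum>y'\<in>V. p y' * (Q y y')\<^sup>2))"
  proof (intro sum_mono mult_left_mono pos)
    fix y assume "y \<in> V"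
    have "(of_bool (y \<in> T) * R y)\<^sup>2 \<le> (R y)\<^sup>2" by auto
    also have "\<dots> \<le> (\<Sum>y'\<in>V. p y' * (of_bool (y' \<in> T) * Q y y')\<^sup>2)"
      unfolding R_def by (rule weighted_mean_square_le[OF V])
    also have "\<dots> \<le> (\<Sum>y'\<in>V. p y' * (Q y y')\<^sup>2)"
      by (intro sum_mono mult_left_mono pos) auto
    finally show "(of_bool (y \<in> T) * R y)\<^sup>2 \<le> (\<Sum>y'\<in>V. p y' * (Q y y')\<^sup>2)" .
  qed
  also have "\<dots> = c4 V p U" by (simp add: c4_eq Q_def)
  finally show ?thesis .
qed

text \<open>Splitting \<open>V\<close> by the sign of \<open>c\<close> leaves two subset sums. A
  bound tested on sets thus extends, at the cost of a factor 2, to test functions with values in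
  \<open>[-1, 1]\<close>.\<close>

lemma abs_sum_le_of_subset_sums:
  fixes h c :: "'a \<Rightarrow> real"
  assumes fin: "finite V" and h: "\<And>x. x \<in> V \<Longrightarrow> \<bar>h x\<bar> \<le> 1"
    and c: "\<And>S. S \<subseteq> V \<Longrightarrow> \<bar>sum c S\<bar> \<le> \<epsilon>"
  shows "\<bar>\<Sum>x\<in>V. h x * c x\<bar> \<le> 2 * \<epsilon>"
proof -
  have "\<bar>\<Sum>x\<in>V. h x * c x\<bar> \<le> (\<Sum>x\<in>V. \<bar>h x * c x\<bar>)" by (rule sum_abs)
  also have "\<dots> \<le> (\<Sum>x\<in>V. \<bar>c x\<bar>)"
    using h by (intro sum_mono) (auto simp: abs_mult intro!: mult_left_le_one_le)
  also have "\<dots> = (\<Sum>x\<in>{x\<in>V. 0 \<le> c x} \<union> {x\<in>V. c x < 0}. \<bar>c x\<bar>)"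
    by (intro sum.cong) auto
  also have "\<dots> = (\<Sum>x\<in>{x\<in>V. 0 \<le> c x}. \<bar>c x\<bar>) + (\<Sum>x\<in>{x\<in>V. c x < 0}. \<bar>c x\<bar>)"
    using fin by (intro sum.union_disjoint) auto
  also have "\<dots> = sum c {x\<in>V. 0 \<le> c x} - sum c {x\<in>V. c x < 0}"
    by (simp add: sum_negf[symmetric])
  also have "\<dots> \<le> 2 * \<epsilon>"
    using c[of "{x\<in>V. 0 \<le> c x}"] c[of "{x\<in>V. c x < 0}"] by auto
  finally show ?thesis .
qed

text \<open>With \<open>x'\<close> and \<open>y'\<close> fixed, the sum over \<open>x\<close> and
  \<open>y\<close> is a cut sum of \<open>U\<close> with the two indicators replaced by the
  functions \<open>U x y'\<close> of \<open>x\<close> and \<open>U x' y\<close> of \<open>y\<close>.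
  Each replacement costs a factor 2, and the remaining factor \<open>U x' y'\<close> is at most 1 in
  absolute value.\<close>

lemma c4_le_cut_sum:
  assumes V: "prob_weights V p" and U: "\<And>x y. x \<in> V \<Longrightarrow> y \<in> V \<Longrightarrow> \<bar>U x y\<bar> \<le> 1"
    and cut: "\<And>S T. S \<subseteq> V \<Longrightarrow> T \<subseteq> V \<Longrightarrow> \<bar>cut_sum p U S T\<bar> \<le> \<epsilon>"
  shows "c4 V p U \<le> 4 * \<epsilon>"
proof -
  have fin: "finite V" and pos: "\<And>v. v \<in> V \<Longrightarrow> 0 \<le> p v" and one: "sum p V = 1"
    using V by (auto simp: prob_weights_def intro: less_imp_le)
  define B where "B x' y' = (\<Sum>x\<in>V. U x y' * (\<Sum>y\<in>V. U x' y * (p x * p y * U x y)))" for x' y'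
  have B: "\<bar>B x' y'\<bar> \<le> 4 * \<epsilon>" if "x' \<in> V" "y' \<in> V" for x' y'
  proof -
    have "\<bar>\<Sum>x\<in>S. \<Sum>y\<in>V. U x' y * (p x * p y * U x y)\<bar> \<le> 2 * \<epsilon>" if S: "S \<subseteq> V" for S
    proof -
      have "\<bar>\<Sum>y\<in>V. U x' y * (\<Sum>x\<in>S. p x * p y * U x y)\<bar> \<le> 2 * \<epsilon>"
      proof (rule abs_sum_le_of_subset_sums[OF fin])
        fix T assume "T \<subseteq> V"
        then show "\<bar>\<Sum>y\<in>T. \<Sum>x\<in>S. p x * p y * U x y\<bar> \<le> \<epsilon>"
          using cut[OF S] by (subst sum.swap) (simp add: cut_sum_def)
      qed (use U \<open>x' \<in> V\<close> in auto)
      then show ?thesis by (subst sum.swap) (simp add: sum_distrib_left)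
    qed
    then have "\<bar>B x' y'\<bar> \<le> 2 * (2 * \<epsilon>)" unfolding B_def
      by (intro abs_sum_le_of_subset_sums[OF fin]) (use U \<open>y' \<in> V\<close> in auto)
    then show ?thesis by simp
  qed
  have e: "0 \<le> \<epsilon>" using cut[of "{}" "{}"] by auto
  have "c4 V p U = (\<Sum>x'\<in>V. \<Sum>y'\<in>V. \<Sum>x\<in>V. \<Sum>y\<in>V.
     p x * p x' * p y * p y' * (U x y * U x' y * U x y' * U x' y'))"
  proof -
    have "c4 V p U = (\<Sum>y\<in>V. \<Sum>y'\<in>V. \<Sum>x'\<in>V. \<Sum>x\<in>V.
      p x * p x' * p y * p y' * (U x y * U x' y * U x y' * U x' y'))"
      unfolding c4_def by (rule sum.cong[OF refl], rule sum.cong[OF refl], rule sum.swap)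
    also have "\<dots> = (\<Sum>y\<in>V. \<Sum>x'\<in>V. \<Sum>y'\<in>V. \<Sum>x\<in>V.
      p x * p x' * p y * p y' * (U x y * U x' y * U x y' * U x' y'))"
      by (rule sum.cong[OF refl], rule sum.swap)
    also have "\<dots> = (\<Sum>x'\<in>V. \<Sum>y\<in>V. \<Sum>y'\<in>V. \<Sum>x\<in>V.
      p x * p x' * p y * p y' * (U x y * U x' y * U x y' * U x' y'))"
      by (rule sum.swap)
    also have "\<dots> = (\<Sum>x'\<in>V. \<Sum>y'\<in>V. \<Sum>y\<in>V. \<Sum>x\<in>V.
      p x * p x' * p y * p y' * (U x y * U x' y * U x y' * U x' y'))"
      by (rule sum.cong[OF refl], rule sum.swap)
    also have "\<dots> = (\<Sum>x'\<in>V. \<Sum>y'\<in>V. \<Sum>x\<in>V. \<Sum>y\<in>V.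
      p x * p x' * p y * p y' * (U x y * U x' y * U x y' * U x' y'))"
      by (rule sum.cong[OF refl], rule sum.cong[OF refl], rule sum.swap)
    finally show ?thesis .
  qed
  also have "\<dots> = (\<Sum>x'\<in>V. p x' * (\<Sum>y'\<in>V. p y' * (U x' y' * B x' y')))"
    by (simp add: B_def sum_distrib_left mult_ac)
  also have "\<dots> \<le> (\<Sum>x'\<in>V. p x' * (\<Sum>y'\<in>V. p y' * (4 * \<epsilon>)))"
  proof (intro sum_mono mult_left_mono pos)
    fix x' y' assume xy: "x' \<in> V" "y' \<in> V"
    have "\<bar>U x' y' * B x' y'\<bar> \<le> 1 * (4 * \<epsilon>)"
      unfolding abs_mult using U[OF xy] B[OF xy] by (intro mult_mono) auto
    then show "U x' y' * B x' y' \<le> 4 * \<epsilon>" by simp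
  qed
  also have "\<dots> = 4 * \<epsilon>" by (simp add: sum_distrib_right[symmetric] one)
  finally show ?thesis .
qed

lemma clip_dist_le:
  fixes w z :: real
  assumes "0 \<le> w" "w \<le> 1"
  shows "(w - max 0 (min 1 z))\<^sup>2 \<le> (w - z)\<^sup>2"
  unfolding abs_le_square_iff[symmetric] using assms by (auto simp: max_def min_def)

section \<open>Weak regularity\<close>

text \<open>As long as some cut sum of the error exceeds \<open>\<epsilon>\<close>, adding \<open>\<plusminus>\<epsilon>\<close> on the rectangle \<open>S \<times> T\<close> decreases the
  squared error by \<open>\<epsilon>\<^sup>2\<close>. Clipping to the unit interval does not increase the error and keeps
  it bounded by 1, as needed to pass from cut sums to 4-cycles.\<close>

lemma weak_regularity_iteration:
  assumes V: "prob_weights V p" and W: "\<And>x y. x \<in> V \<Longrightarrow> y \<in> V \<Longrightarrow> 0 \<le> W x y \<and> W x y \<le> 1" and e: "0 < \<epsilon>"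
  shows "\<exists>(\<tau> :: nat \<Rightarrow> nat) \<kappa>. (\<forall>v\<in>V. \<tau> v < 4 ^ n) \<and> (\<forall>s t. 0 \<le> \<kappa> s t \<and> \<kappa> s t \<le> 1) \<and>
    ((\<forall>S T. S \<subseteq> V \<longrightarrow> T \<subseteq> V \<longrightarrow> \<bar>cut_sum p (\<lambda>x y. W x y - \<kappa> (\<tau> x) (\<tau> y)) S T\<bar> \<le> \<epsilon>) \<or>
     (\<Sum>x\<in>V. \<Sum>y\<in>V. p x * p y * (W x y - \<kappa> (\<tau> x) (\<tau> y))\<^sup>2) \<le> 1 - real n * \<epsilon>\<^sup>2)"
proof (induction n)
  have fin: "finite V" and pos: "\<And>v. v \<in> V \<Longrightarrow> 0 \<le> p v" and one: "sum p V = 1"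
    using V by (auto simp: prob_weights_def intro: less_imp_le)
  have one2: "(\<Sum>x\<in>V. \<Sum>y\<in>V. p x * p y) = 1"
    by (simp add: sum_product[symmetric] one)
  {
    case 0
    have "(\<Sum>x\<in>V. \<Sum>y\<in>V. p x * p y * (W x y - 0)\<^sup>2) \<le> (\<Sum>x\<in>V. \<Sum>y\<in>V. p x * p y)"
      using W pos by (intro sum_mono) (auto intro!: mult_right_le_one_le power_le_one)
    then show ?case
      using one2 by (intro exI[of _ "\<lambda>_. 0"] exI[of _ "\<lambda>_ _. 0"]) auto
  next
    case (Suc n)
    then obtain \<tau> :: "nat \<Rightarrow> nat" and \<kappa> where tk: "\<forall>v\<in>V. \<tau> v < 4 ^ n" "\<forall>s t. 0 \<le> \<kappa> s t \<and> \<kappa> s t \<le> 1"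
      and alt: "(\<forall>S T. S \<subseteq> V \<longrightarrow> T \<subseteq> V \<longrightarrow> \<bar>cut_sum p (\<lambda>x y. W x y - \<kappa> (\<tau> x) (\<tau> y)) S T\<bar> \<le> \<epsilon>) \<or>
     (\<Sum>x\<in>V. \<Sum>y\<in>V. p x * p y * (W x y - \<kappa> (\<tau> x) (\<tau> y))\<^sup>2) \<le> 1 - real n * \<epsilon>\<^sup>2"
      by blast
    show ?case
    proof (cases "\<forall>S T. S \<subseteq> V \<longrightarrow> T \<subseteq> V \<longrightarrow> \<bar>cut_sum p (\<lambda>x y. W x y - \<kappa> (\<tau> x) (\<tau> y)) S T\<bar> \<le> \<epsilon>")
      case True
      have "\<forall>v\<in>V. \<tau> v < 4 ^ Suc n" using tk(1) by (auto intro: less_le_trans)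
      then show ?thesis using True tk(2) by blast
    next
      case False
      define U where "U x y = W x y - \<kappa> (\<tau> x) (\<tau> y)" for x y
      from False obtain S T where ST: "S \<subseteq> V" "T \<subseteq> V" "\<bar>cut_sum p U S T\<bar> > \<epsilon>"
        unfolding U_def by (auto simp: not_le)
      define \<sigma> :: real where "\<sigma> = sgn (cut_sum p U S T)"
      have s: "\<bar>\<sigma>\<bar> = 1" "\<sigma> * cut_sum p U S T = \<bar>cut_sum p U S T\<bar>"
        using ST(3) e by (auto simp: \<sigma>_def sgn_if)
      define I where "I x y = (of_bool (x \<in> S \<and> y \<in> T) :: real)" for x y
      \<comment> \<open>the two new low-order bits record membership in \<open>S\<close> and \<open>T\<close>\<close>
      define \<tau>' where "\<tau>' v = 4 * \<tau> v + 2 * of_bool (v \<in> S) + of_bool (v \<in> T)" for v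
      define \<kappa>' where "\<kappa>' s t = max 0 (min 1 (\<kappa> (s div 4) (t div 4) +
          \<sigma> * \<epsilon> * of_bool (s div 2 mod 2 = 1 \<and> t mod 2 = 1)))" for s t :: nat
      have dec: "\<tau>' v div 4 = \<tau> v" "\<tau>' v div 2 mod 2 = 1 \<longleftrightarrow> v \<in> S" "\<tau>' v mod 2 = 1 \<longleftrightarrow> v \<in> T" for v
        unfolding \<tau>'_def by (cases "v \<in> S"; cases "v \<in> T"; simp; presburger)+
      have k': "\<kappa>' (\<tau>' x) (\<tau>' y) = max 0 (min 1 (\<kappa> (\<tau> x) (\<tau> y) + \<sigma> * \<epsilon> * I x y))" for x y
        by (simp only: \<kappa>'_def dec I_def)
      have t': "\<forall>v\<in>V. \<tau>' v < 4 ^ Suc n"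
      proof
        fix v assume "v \<in> V"
        then have "\<tau> v + 1 \<le> 4 ^ n" using tk(1) by (simp add: Suc_le_eq)
        then have "4 * (\<tau> v + 1) \<le> 4 ^ Suc n" by simp
        then show "\<tau>' v < 4 ^ Suc n" by (simp add: \<tau>'_def)
      qed
      have "(\<Sum>x\<in>V. \<Sum>y\<in>V. p x * p y * (W x y - \<kappa>' (\<tau>' x) (\<tau>' y))\<^sup>2)
        \<le> (\<Sum>x\<in>V. \<Sum>y\<in>V. p x * p y * (U x y - \<sigma> * \<epsilon> * I x y)\<^sup>2)"
      proof (intro sum_mono mult_left_mono)
        fix x y assume "x \<in> V" "y \<in> V"
        then show "(W x y - \<kappa>' (\<tau>' x) (\<tau>' y))\<^sup>2 \<le> (U x y - \<sigma> * \<epsilon> * I x y)\<^sup>2"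
          unfolding k' using clip_dist_le[of "W x y" "\<kappa> (\<tau> x) (\<tau> y) + \<sigma> * \<epsilon> * I x y"] W[of x y]
          by (simp add: U_def algebra_simps)
      qed (use pos in auto)
      \<comment> \<open>The cross term is below \<open>-2 * \<epsilon>\<^sup>2\<close>, as the cut
        sum exceeds \<open>\<epsilon>\<close> in absolute value, and the last term is at most
        \<open>\<epsilon>\<^sup>2\<close>, as the rectangle has weight at most 1.\<close>
      also have "\<dots> = (\<Sum>x\<in>V. \<Sum>y\<in>V. p x * p y * (U x y)\<^sup>2 - 2 * \<epsilon> * \<sigma> * (p x * p y * U x y * I x y)
           + \<epsilon>\<^sup>2 * \<sigma>\<^sup>2 * (p x * p y * I x y))"
        by (intro sum.cong refl) (auto simp: I_def power2_eq_square algebra_simps)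
      also have "\<dots> = (\<Sum>x\<in>V. \<Sum>y\<in>V. p x * p y * (U x y)\<^sup>2)
           - 2 * \<epsilon> * \<sigma> * (\<Sum>x\<in>V. \<Sum>y\<in>V. p x * p y * U x y * I x y)
           + \<epsilon>\<^sup>2 * \<sigma>\<^sup>2 * (\<Sum>x\<in>V. \<Sum>y\<in>V. p x * p y * I x y)"
        by (simp add: sum.distrib sum_subtractf sum_distrib_left)
      also have "(\<Sum>x\<in>V. \<Sum>y\<in>V. p x * p y * U x y * I x y) = cut_sum p U S T"
      proof -
        have "cut_sum p U S T = (\<Sum>x\<in>S. \<Sum>y\<in>V. p x * p y * U x y * I x y)"
          unfolding cut_sum_def
          by (intro sum.cong refl sum.mono_neutral_cong_left) (use ST fin in \<open>auto simp: I_def\<close>)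
        also have "\<dots> = (\<Sum>x\<in>V. \<Sum>y\<in>V. p x * p y * U x y * I x y)"
          by (intro sum.mono_neutral_cong_left) (use ST fin in \<open>auto simp: I_def\<close>)
        finally show ?thesis by simp
      qed
      also have "2 * \<epsilon> * \<sigma> * cut_sum p U S T = 2 * \<epsilon> * \<bar>cut_sum p U S T\<bar>" using s(2) by simp
      also have "\<sigma>\<^sup>2 = 1" using s(1) by (metis abs_power2 one_power2 power2_abs)
      also have "(\<Sum>x\<in>V. \<Sum>y\<in>V. p x * p y * (U x y)\<^sup>2) - 2 * \<epsilon> * \<bar>cut_sum p U S T\<bar>
           + \<epsilon>\<^sup>2 * 1 * (\<Sum>x\<in>V. \<Sum>y\<in>V. p x * p y * I x y)
         \<le> (1 - real n * \<epsilon>\<^sup>2) - 2 * \<epsilon> * \<epsilon> + \<epsilon>\<^sup>2 * 1 * 1"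
      proof (intro add_mono diff_mono mult_left_mono)
        show "(\<Sum>x\<in>V. \<Sum>y\<in>V. p x * p y * (U x y)\<^sup>2) \<le> 1 - real n * \<epsilon>\<^sup>2"
          using alt False unfolding U_def by blast
        have "(\<Sum>x\<in>V. \<Sum>y\<in>V. p x * p y * I x y) \<le> (\<Sum>x\<in>V. \<Sum>y\<in>V. p x * p y)"
          using pos by (intro sum_mono) (auto simp: I_def)
        then show "(\<Sum>x\<in>V. \<Sum>y\<in>V. p x * p y * I x y) \<le> 1" by (simp only: one2)
      qed (use ST e in auto)
      also have "\<dots> = 1 - real (Suc n) * \<epsilon>\<^sup>2" by (simp add: power2_eq_square algebra_simps)
      finally have "(\<Sum>x\<in>V. \<Sum>y\<in>V. p x * p y * (W x y - \<kappa>' (\<tau>' x) (\<tau>' y))\<^sup>2) \<le> 1 - real (Suc n) * \<epsilon>\<^sup>2" .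
      moreover have "\<forall>s t. 0 \<le> \<kappa>' s t \<and> \<kappa>' s t \<le> 1" by (simp add: \<kappa>'_def)
      ultimately show ?thesis using t' by blast
    qed
  }
qed

text \<open>The squared error is nonnegative, so after more than
  \<open>1 / \<epsilon>\<^sup>2\<close> rounds only the first alternative of the iteration is
  possible. The number of types depends on \<open>\<eta>\<close> alone and serves all
  graphs.\<close>

lemma weak_regularity:
  assumes "0 < \<eta>"
  obtains M :: nat where "\<forall>V p W. prob_weights V p \<longrightarrow> (\<forall>x\<in>V. \<forall>y\<in>V. 0 \<le> W x y \<and> W x y \<le> 1) \<longrightarrow>
    (\<exists>(\<tau> :: nat \<Rightarrow> nat) \<kappa>. (\<forall>v\<in>V. \<tau> v < M) \<and> (\<forall>s t. 0 \<le> \<kappa> s t \<and> \<kappa> s t \<le> 1) \<and>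
      c4 V p (\<lambda>x y. W x y - \<kappa> (\<tau> x) (\<tau> y)) \<le> \<eta>)"
proof -
  \<comment> \<open>Compensates the factor 4 in \<open>c4_le_cut_sum\<close>.\<close>
  define \<epsilon> where "\<epsilon> = \<eta> / 4"
  have e: "0 < \<epsilon>" using assms by (simp add: \<epsilon>_def)
  obtain n :: nat where n: "1 / \<epsilon>\<^sup>2 < n" using reals_Archimedean2 by blast
  have "\<exists>(\<tau> :: nat \<Rightarrow> nat) \<kappa>. (\<forall>v\<in>V. \<tau> v < 4 ^ n) \<and> (\<forall>s t. 0 \<le> \<kappa> s t \<and> \<kappa> s t \<le> 1) \<and>
      c4 V p (\<lambda>x y. W x y - \<kappa> (\<tau> x) (\<tau> y)) \<le> \<eta>"
    if V: "prob_weights V p" and W: "\<And>x y. x \<in> V \<Longrightarrow> y \<in> V \<Longrightarrow> 0 \<le> W x y \<and> W x y \<le> 1" for V p W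
  proof -
    obtain \<tau> :: "nat \<Rightarrow> nat" and \<kappa> where tk: "\<forall>v\<in>V. \<tau> v < 4 ^ n" "\<forall>s t. 0 \<le> \<kappa> s t \<and> \<kappa> s t \<le> 1"
      and alt: "(\<forall>S T. S \<subseteq> V \<longrightarrow> T \<subseteq> V \<longrightarrow> \<bar>cut_sum p (\<lambda>x y. W x y - \<kappa> (\<tau> x) (\<tau> y)) S T\<bar> \<le> \<epsilon>) \<or>
     (\<Sum>x\<in>V. \<Sum>y\<in>V. p x * p y * (W x y - \<kappa> (\<tau> x) (\<tau> y))\<^sup>2) \<le> 1 - real n * \<epsilon>\<^sup>2"
      using weak_regularity_iteration[where n = n and W = W, OF V W e] by blast
    have "0 \<le> (\<Sum>x\<in>V. \<Sum>y\<in>V. p x * p y * (W x y - \<kappa> (\<tau> x) (\<tau> y))\<^sup>2)"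
      using V by (intro sum_nonneg mult_nonneg_nonneg) (auto simp: prob_weights_def intro: less_imp_le)
    moreover have "1 - real n * \<epsilon>\<^sup>2 < 0" using n e by (simp add: field_simps)
    ultimately have cut: "\<And>S T. S \<subseteq> V \<Longrightarrow> T \<subseteq> V \<Longrightarrow> \<bar>cut_sum p (\<lambda>x y. W x y - \<kappa> (\<tau> x) (\<tau> y)) S T\<bar> \<le> \<epsilon>"
      using alt by auto
    have "\<bar>W x y - \<kappa> (\<tau> x) (\<tau> y)\<bar> \<le> 1" if "x \<in> V" "y \<in> V" for x y
      using W[OF that] tk(2)[rule_format, of "\<tau> x" "\<tau> y"] by (simp add: abs_le_iff)
    then have "c4 V p (\<lambda>x y. W x y - \<kappa> (\<tau> x) (\<tau> y)) \<le> \<eta>"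
      using c4_le_cut_sum[OF V _ cut] by (simp add: \<epsilon>_def)
    then show ?thesis using tk by blast
  qed
  then show thesis by (intro that[of "4 ^ n"] allI impI) auto
qed

section \<open>Random samples\<close>

lemma expectation_bind_finite:
  fixes h :: "'b \<Rightarrow> real"
  assumes "finite (set_pmf p)" "\<And>x. x \<in> set_pmf p \<Longrightarrow> finite (set_pmf (f x))"
  shows "measure_pmf.expectation (bind_pmf p f) h =
    measure_pmf.expectation p (\<lambda>x. measure_pmf.expectation (f x) h)"
  using assms by (subst pmf_expectation_bind[of "set_pmf p"]) (auto simp: integral_measure_pmf[of "set_pmf p" p])

lemma finite_set_Pi_pmf:
  assumes "finite A" "\<And>x. x \<in> A \<Longrightarrow> finite (set_pmf (p x))"
  shows "finite (set_pmf (Pi_pmf A d p))"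
  using assms by (auto simp: set_Pi_pmf)

lemma expectation_Pi_pmf_insert:
  fixes F :: "_ \<Rightarrow> real"
  assumes "finite A" "x \<notin> A" "\<And>y. y \<in> insert x A \<Longrightarrow> finite (set_pmf (p y))"
  shows "measure_pmf.expectation (Pi_pmf (insert x A) d p) F =
    measure_pmf.expectation (p x) (\<lambda>y. measure_pmf.expectation (Pi_pmf A d p) (\<lambda>f. F (f(x := y))))"
proof -
  have fin: "finite (set_pmf (Pi_pmf A d p))" using assms by (intro finite_set_Pi_pmf) auto
  then show ?thesis
    using assms by (simp add: Pi_pmf_insert' expectation_bind_finite)
qed

text \<open>Independence of the coordinates; injectivity of \<open>e\<close> ensures that different
  factors read different ones. The induction removes the coordinate \<open>e l\<close> from
  \<open>A\<close>, so \<open>A\<close> has to vary.\<close>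

lemma expectation_Pi_pmf_prod:
  fixes g :: "'l \<Rightarrow> 'b \<Rightarrow> real"
  assumes "finite L" "finite A" "inj_on e L" "e ` L \<subseteq> A" "\<And>y. y \<in> A \<Longrightarrow> finite (set_pmf (p y))"
  shows "measure_pmf.expectation (Pi_pmf A d p) (\<lambda>f. \<Prod>l\<in>L. g l (f (e l))) =
    (\<Prod>l\<in>L. measure_pmf.expectation (p (e l)) (g l))"
  using assms
proof (induction L arbitrary: A rule: finite_induct)
  case (insert l L)
  have A: "A = insert (e l) (A - {e l})" using insert.prems by auto
  have ne: "e l' \<noteq> e l" if "l' \<in> L" for l'
    using inj_onD[OF insert.prems(2), of l' l] insert.hyps that by auto
  have sub: "e ` L \<subseteq> A - {e l}"
  proof
    fix z assume "z \<in> e ` L"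
    then obtain l' where l': "l' \<in> L" "z = e l'" by auto
    then have "z \<in> A" using insert.prems(3) by auto
    then show "z \<in> A - {e l}" using ne[OF l'(1)] l'(2) by simp
  qed
  have "measure_pmf.expectation (Pi_pmf A d p) (\<lambda>f. \<Prod>l\<in>insert l L. g l (f (e l))) =
    measure_pmf.expectation (p (e l)) (\<lambda>y. measure_pmf.expectation (Pi_pmf (A - {e l}) d p)
      (\<lambda>f. \<Prod>l'\<in>insert l L. g l' ((f(e l := y)) (e l'))))"
    by (subst A, subst expectation_Pi_pmf_insert) (use insert.prems in auto)
  also have "\<dots> = measure_pmf.expectation (p (e l)) (\<lambda>y. measure_pmf.expectation (Pi_pmf (A - {e l}) d p)
      (\<lambda>f. g l y * (\<Prod>l'\<in>L. g l' (f (e l')))))"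
  proof -
    have "(\<Prod>l'\<in>insert l L. g l' ((f(e l := y)) (e l'))) = g l y * (\<Prod>l'\<in>L. g l' (f (e l')))" for f y
    proof -
      have "(\<Prod>l'\<in>L. g l' ((f(e l := y)) (e l'))) = (\<Prod>l'\<in>L. g l' (f (e l')))"
        using ne by (intro prod.cong) auto
      then show ?thesis using insert.hyps by simp
    qed
    then show ?thesis by simp
  qed
  also have "\<dots> = measure_pmf.expectation (p (e l)) (\<lambda>y. g l y * (\<Prod>l'\<in>L. measure_pmf.expectation (p (e l')) (g l')))"
    using insert.prems insert.hyps sub by (subst integral_mult_right_zero, subst insert.IH) auto
  also have "\<dots> = (\<Prod>l\<in>insert l L. measure_pmf.expectation (p (e l)) (g l))"
    using insert.hyps by simp
  finally show ?case .
qed simp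

section \<open>Normalised vertex weights and the joint law of sampled vertices and edges\<close>

definition vprob :: "wgraph \<Rightarrow> nat \<Rightarrow> real" where
  "vprob G i = vweight G i / total_weight G"

lemma total_weight_pos: "G \<in> weighted_graphs \<Longrightarrow> 0 < total_weight G"
  unfolding total_weight_def weight_def
  by (intro sum_pos) (auto simp: weighted_graphs_def verts_def)

lemma prob_weights_vprob: "G \<in> weighted_graphs \<Longrightarrow> prob_weights (verts G) (vprob G)"
  using total_weight_pos[of G]
  by (auto simp: prob_weights_def vprob_def weighted_graphs_def sum_divide_distrib[symmetric]
      total_weight_def weight_def verts_def)

lemma set_pmf_random_vertex: "G \<in> weighted_graphs \<Longrightarrow> set_pmf (random_vertex G) = verts G"
  using total_weight_pos[of G]
  by (auto simp: set_pmf_eq pmf_random_vertex weighted_graphs_def)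

lemma finite_verts: "finite (verts G)" by (simp add: verts_def)

lemma expectation_random_vertex:
  fixes f :: "nat \<Rightarrow> real"
  assumes "G \<in> weighted_graphs"
  shows "measure_pmf.expectation (random_vertex G) f = (\<Sum>i\<in>verts G. vprob G i * f i)"
  using assms
  by (subst integral_measure_pmf[of "verts G"])
    (auto simp: finite_verts set_pmf_random_vertex pmf_random_vertex vprob_def)

definition pair_edges :: "nat \<Rightarrow> wgraph \<Rightarrow> (nat \<Rightarrow> nat) \<Rightarrow> (nat \<times> nat \<Rightarrow> bool) pmf" where
  "pair_edges k G \<Phi> = Pi_pmf {(u, v). 1 \<le> u \<and> u < v \<and> v \<le> k} False
     (\<lambda>(u, v). bernoulli_pmf (eweight G (\<Phi> u) (\<Phi> v)))"

definition sample_vertices :: "nat \<Rightarrow> wgraph \<Rightarrow> (nat \<Rightarrow> nat) pmf" where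
  "sample_vertices k G = Pi_pmf {1..k} 0 (\<lambda>_. random_vertex G)"

text \<open>The types of the sampled vertices and the pulled-back kernel depend on
  \<open>\<Phi>\<close>, which \<open>sample\<close> forgets; the pair keeps it.\<close>

definition joint_sample :: "nat \<Rightarrow> wgraph \<Rightarrow> ((nat \<Rightarrow> nat) \<times> (nat \<times> nat \<Rightarrow> bool)) pmf" where
  "joint_sample k G = bind_pmf (sample_vertices k G) (\<lambda>\<Phi>. map_pmf (Pair \<Phi>) (pair_edges k G \<Phi>))"

lemma sample_eq_joint: "sample k G = map_pmf (\<lambda>(\<Phi>, E). simple_graph k E) (joint_sample k G)"
  by (simp add: sample_def joint_sample_def sample_vertices_def pair_edges_def map_bind_pmf pmf.map_comp o_def)

lemma finite_pairs: "finite {(u, v). 1 \<le> u \<and> u < v \<and> v \<le> (k::nat)}"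
  by (rule finite_subset[of _ "{..k} \<times> {..k}"]) auto

lemma finite_set_pair_edges: "finite (set_pmf (pair_edges k G \<Phi>))"
  unfolding pair_edges_def
  by (intro finite_set_Pi_pmf finite_pairs) auto

lemma finite_set_sample_vertices: "G \<in> weighted_graphs \<Longrightarrow> finite (set_pmf (sample_vertices k G))"
  unfolding sample_vertices_def
  by (intro finite_set_Pi_pmf) (auto simp: set_pmf_random_vertex finite_verts)

lemma set_sample_vertices:
  assumes "G \<in> weighted_graphs" "\<Phi> \<in> set_pmf (sample_vertices k G)" "u \<in> {1..k}"
  shows "\<Phi> u \<in> verts G"
  using assms by (auto simp: sample_vertices_def set_Pi_pmf PiE_dflt_def set_pmf_random_vertex)

lemma expectation_joint:
  fixes h :: "_ \<Rightarrow> real"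
  assumes "G \<in> weighted_graphs"
  shows "measure_pmf.expectation (joint_sample k G) h =
    measure_pmf.expectation (sample_vertices k G) (\<lambda>\<Phi>. measure_pmf.expectation (pair_edges k G \<Phi>) (\<lambda>E. h (\<Phi>, E)))"
  unfolding joint_sample_def
  by (subst expectation_bind_finite) (auto simp: finite_set_sample_vertices finite_set_pair_edges assms)

lemma finite_set_joint: "G \<in> weighted_graphs \<Longrightarrow> finite (set_pmf (joint_sample k G))"
  by (auto simp: joint_sample_def finite_set_sample_vertices finite_set_pair_edges)

lemma integrable_joint:
  fixes h :: "_ \<Rightarrow> real"
  shows "G \<in> weighted_graphs \<Longrightarrow> integrable (measure_pmf (joint_sample k G)) h"
  by (intro integrable_measure_pmf_finite finite_set_joint)

section \<open>Moments of the sample: 4-cycle density and type counts\<close>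

lemma expectation_sample_vertices_4:
  fixes F :: "nat \<Rightarrow> nat \<Rightarrow> nat \<Rightarrow> nat \<Rightarrow> real"
  assumes G: "G \<in> weighted_graphs"
    and "y \<in> {1..k}" "y' \<in> {1..k}" "x \<in> {1..k}" "x' \<in> {1..k}" "distinct [y, y', x, x']"
  shows "measure_pmf.expectation (sample_vertices k G) (\<lambda>\<Phi>. F (\<Phi> y) (\<Phi> y') (\<Phi> x) (\<Phi> x')) =
    (\<Sum>j\<in>verts G. vprob G j * (\<Sum>j'\<in>verts G. vprob G j' * (\<Sum>i\<in>verts G. vprob G i * (\<Sum>i'\<in>verts G. vprob G i' * F j j' i i'))))"
proof -
  have k: "{1..k} = insert y (insert y' (insert x (insert x' ({1..k} - {y, y', x, x'}))))"
    using assms by auto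
  have fin: "finite (set_pmf (random_vertex G))" using G by (simp add: set_pmf_random_vertex finite_verts)
  show ?thesis unfolding sample_vertices_def
    apply (subst k)
    apply (subst expectation_Pi_pmf_insert)
    using assms(6) fin apply auto[3]
    apply (subst expectation_Pi_pmf_insert)
    using assms(6) fin apply auto[3]
    apply (subst expectation_Pi_pmf_insert)
    using assms(6) fin apply auto[3]
    apply (subst expectation_Pi_pmf_insert)
    using assms(6) fin apply auto[3]
    using assms(6) by (auto simp: expectation_random_vertex[OF G])
qed

lemma expectation_sample_vertices_2:
  fixes F :: "nat \<Rightarrow> nat \<Rightarrow> real"
  assumes G: "G \<in> weighted_graphs"
    and "x \<in> {1..k}" "y \<in> {1..k}" "x \<noteq> y"
  shows "measure_pmf.expectation (sample_vertices k G) (\<lambda>\<Phi>. F (\<Phi> x) (\<Phi> y)) =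
    (\<Sum>i\<in>verts G. vprob G i * (\<Sum>j\<in>verts G. vprob G j * F i j))"
proof -
  have k: "{1..k} = insert x (insert y ({1..k} - {x, y}))"
    using assms by auto
  have fin: "finite (set_pmf (random_vertex G))" using G by (simp add: set_pmf_random_vertex finite_verts)
  show ?thesis unfolding sample_vertices_def
    apply (subst k)
    apply (subst expectation_Pi_pmf_insert)
    using assms(4) fin apply auto[3]
    apply (subst expectation_Pi_pmf_insert)
    using assms(4) fin apply auto[3]
    using assms(4) by (auto simp: expectation_random_vertex[OF G])
qed

text \<open>The edges of a 4-cycle on distinct vertices are four different unordered pairs, hence
  independent once \<open>\<Phi>\<close> is fixed, and each factor is affine in the indicator of its
  own edge.\<close>

lemma expectation_adjacency_4:
  fixes c :: "nat \<Rightarrow> nat \<Rightarrow> real"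
  assumes G: "G \<in> weighted_graphs" and \<Phi>: "\<And>u. u \<in> {1..k} \<Longrightarrow> \<Phi> u \<in> verts G"
    and k: "y \<in> {1..k}" "y' \<in> {1..k}" "x \<in> {1..k}" "x' \<in> {1..k}" and d: "distinct [y, y', x, x']"
  defines "H \<equiv> \<lambda>E u v. eweight (simple_graph k E) u v - c u v"
    and "U \<equiv> \<lambda>u v. eweight G (\<Phi> u) (\<Phi> v) - c u v"
  shows "measure_pmf.expectation (pair_edges k G \<Phi>) (\<lambda>E. H E x y * H E x' y * H E x y' * H E x' y') =
    U x y * U x' y * U x y' * U x' y'"
proof -
  define L where "L = {(x, y), (x', y), (x, y'), (x', y')}"
  \<comment> \<open>\<open>E\<close> is sampled only at pairs in increasing order; \<open>e\<close>
    sends an edge of the cycle to its coordinate.\<close>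
  define e where "e = (\<lambda>(u, v). (min u v, max u v :: nat))"
  define g where "g l b = (of_bool b - c (fst l) (snd l))" for l and b :: bool
  have inj: "inj_on e L" using d by (auto simp: L_def e_def inj_on_def min_def max_def split: if_splits)
  have "H E u v = g (u, v) (E (e (u, v)))" if "(u, v) \<in> L" for u v E
    using that d by (auto simp: L_def H_def g_def e_def simple_graph_def min_def max_def)
  then have "H E x y * H E x' y * H E x y' * H E x' y' = (\<Prod>l\<in>L. g l (E (e l)))" for E
    using d by (simp add: L_def)
  then have "measure_pmf.expectation (pair_edges k G \<Phi>) (\<lambda>E. H E x y * H E x' y * H E x y' * H E x' y')
    = (\<Prod>l\<in>L. measure_pmf.expectation (case e l of (u, v) \<Rightarrow> bernoulli_pmf (eweight G (\<Phi> u) (\<Phi> v))) (g l))"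
    unfolding pair_edges_def
    by (simp only:) (rule expectation_Pi_pmf_prod,
        use inj finite_pairs k d in \<open>auto simp: L_def e_def min_def max_def\<close>)
  also have "\<dots> = (\<Prod>l\<in>L. U (fst l) (snd l))"
  proof (rule prod.cong[OF refl])
    fix l assume "l \<in> L"
    then have l: "fst l \<in> {1..k}" "snd l \<in> {1..k}" using k by (auto simp: L_def)
    define b where "b = eweight G (\<Phi> (fst l)) (\<Phi> (snd l))"
    have b: "0 \<le> b" "b \<le> 1" "b = eweight G (\<Phi> (snd l)) (\<Phi> (fst l))"
      using G \<Phi>[OF l(1)] \<Phi>[OF l(2)] by (auto simp: b_def weighted_graphs_def)
    \<comment> \<open>\<open>e\<close> may have swapped the endpoints, which the symmetry of
      \<open>eweight\<close> undoes.\<close>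
    have "(case e l of (u, v) \<Rightarrow> bernoulli_pmf (eweight G (\<Phi> u) (\<Phi> v))) = bernoulli_pmf b"
      using b(3) by (auto simp: e_def min_def max_def b_def split: prod.splits)
    moreover have "measure_pmf.expectation (bernoulli_pmf b) (g l) = b - c (fst l) (snd l)"
      using b by (simp add: g_def algebra_simps)
    ultimately show "measure_pmf.expectation (case e l of (u, v) \<Rightarrow> bernoulli_pmf (eweight G (\<Phi> u) (\<Phi> v))) (g l)
      = U (fst l) (snd l)" by (simp add: U_def b_def)
  qed
  also have "\<dots> = U x y * U x' y * U x y' * U x' y'" using d by (simp add: L_def)
  finally show ?thesis .
qed

lemma expectation_le_1:
  fixes f :: "'a \<Rightarrow> real"
  assumes "finite (set_pmf p)" "\<And>x. x \<in> set_pmf p \<Longrightarrow> f x \<le> 1"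
  shows "measure_pmf.expectation p f \<le> 1"
proof -
  have "measure_pmf.expectation p f \<le> measure_pmf.expectation p (\<lambda>_. 1)"
    using assms by (intro integral_mono_AE integrable_measure_pmf_finite AE_pmfI) auto
  then show ?thesis by simp
qed

definition sample_deviation :: "nat \<Rightarrow> (nat \<Rightarrow> nat) \<Rightarrow> (nat \<Rightarrow> nat \<Rightarrow> real) \<Rightarrow> (nat \<Rightarrow> nat) \<times> (nat \<times> nat \<Rightarrow> bool) \<Rightarrow> nat \<Rightarrow> nat \<Rightarrow> real" where
  "sample_deviation k \<tau> \<kappa> = (\<lambda>(\<Phi>, E) u v. eweight (simple_graph k E) u v - \<kappa> (\<tau> (\<Phi> u)) (\<tau> (\<Phi> v)))"

lemma c4_nonneg: "prob_weights V p \<Longrightarrow> 0 \<le> c4 V p U"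
  unfolding c4_eq by (intro sum_nonneg mult_nonneg_nonneg) (auto simp: prob_weights_def intro: less_imp_le)

lemma prob_weights_uniform: "k \<ge> 1 \<Longrightarrow> prob_weights {1..k} (\<lambda>_. 1 / real k)"
  by (simp add: prob_weights_def)

lemma expectation_c4_sample:
  assumes G: "G \<in> weighted_graphs" and k: "k \<ge> 1" and \<kappa>: "\<And>s t. 0 \<le> \<kappa> s t \<and> \<kappa> s t \<le> 1"
  shows "measure_pmf.expectation (joint_sample k G) (\<lambda>\<omega>. c4 {1..k} (\<lambda>_. 1 / real k) (sample_deviation k \<tau> \<kappa> \<omega>))
    \<le> c4 (verts G) (vprob G) (\<lambda>x y. eweight G x y - \<kappa> (\<tau> x) (\<tau> y)) + 6 / k"
proof -
  define C where "C = c4 (verts G) (vprob G) (\<lambda>x y. eweight G x y - \<kappa> (\<tau> x) (\<tau> y))"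
  define K where "K = {1..k}"
  define D where "D = sample_deviation k \<tau> \<kappa>"
  define T where "T y y' x x' \<omega> = D \<omega> x y * D \<omega> x' y * D \<omega> x y' * D \<omega> x' y'" for y y' x x' \<omega>
  let ?E = "measure_pmf.expectation (joint_sample k G)"
  have C: "0 \<le> C" unfolding C_def by (intro c4_nonneg prob_weights_vprob G)
  have D1: "\<bar>D \<omega> u v\<bar> \<le> 1" for \<omega> u v
    using \<kappa>[of "\<tau> (fst \<omega> u)" "\<tau> (fst \<omega> v)"]
    by (auto simp: D_def sample_deviation_def simple_graph_def split: prod.splits)
  have T1: "T y y' x x' \<omega> \<le> 1" for y y' x x' \<omega>
  proof -
    have "\<bar>T y y' x x' \<omega>\<bar> \<le> 1 * 1 * 1 * 1"
      unfolding T_def abs_mult by (intro mult_mono D1) auto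
    then show ?thesis by simp
  qed
  have ET1: "?E (T y y' x x') \<le> 1" for y y' x x'
    by (intro expectation_le_1 finite_set_joint G T1)
  have ET: "?E (T y y' x x') = C" if "y \<in> K" "y' \<in> K" "x \<in> K" "x' \<in> K" "distinct [y, y', x, x']" for y y' x x'
  proof -
    define U where "U u v = eweight G u v - \<kappa> (\<tau> u) (\<tau> v)" for u v
    have "?E (T y y' x x') = measure_pmf.expectation (sample_vertices k G) (\<lambda>\<Phi>.
       measure_pmf.expectation (pair_edges k G \<Phi>) (\<lambda>E. T y y' x x' (\<Phi>, E)))"
      by (rule expectation_joint[OF G])
    also have "\<dots> = measure_pmf.expectation (sample_vertices k G) (\<lambda>\<Phi>.
       U (\<Phi> x) (\<Phi> y) * U (\<Phi> x') (\<Phi> y) * U (\<Phi> x) (\<Phi> y') * U (\<Phi> x') (\<Phi> y'))"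
    proof (intro integral_cong_AE AE_pmfI)
      fix \<Phi> assume "\<Phi> \<in> set_pmf (sample_vertices k G)"
      then have "\<Phi> u \<in> verts G" if "u \<in> {1..k}" for u using set_sample_vertices[OF G] that by blast
      then show "measure_pmf.expectation (pair_edges k G \<Phi>) (\<lambda>E. T y y' x x' (\<Phi>, E)) =
         U (\<Phi> x) (\<Phi> y) * U (\<Phi> x') (\<Phi> y) * U (\<Phi> x) (\<Phi> y') * U (\<Phi> x') (\<Phi> y')"
        unfolding T_def D_def sample_deviation_def prod.case U_def
        using that by (intro expectation_adjacency_4[OF G]) (auto simp: K_def)
    qed auto
    also have "\<dots> = (\<Sum>j\<in>verts G. vprob G j * (\<Sum>j'\<in>verts G. vprob G j' * (\<Sum>i\<in>verts G. vprob G i * (\<Sum>i'\<in>verts G. vprob G i' *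
        (U i j * U i' j * U i j' * U i' j')))))"
      using that by (intro expectation_sample_vertices_4[OF G, where F = "\<lambda>j j' i i'. U i j * U i' j * U i j' * U i' j'"]) (auto simp: K_def)
    also have "\<dots> = C" by (simp add: C_def c4_def U_def sum_distrib_left mult_ac)
    finally show ?thesis .
  qed
  \<comment> \<open>the six summands are the possible coincidences among four vertices\<close>
  let ?b = "\<lambda>y y' x x'. C + of_bool (y' = y) + of_bool (x = y) + of_bool (x' = y) + of_bool (x = y') + of_bool (x' = y') + of_bool (x' = x) :: real"
  have bound: "?E (T y y' x x') \<le> ?b y y' x x'" if "y \<in> K" "y' \<in> K" "x \<in> K" "x' \<in> K" for y y' x x'
  proof (cases "distinct [y, y', x, x']")
    case True then show ?thesis using ET[OF that True] by simp
  next
    case False then show ?thesis using ET1[of y y' x x'] C by (auto simp: of_bool_def)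
  qed
  have cK: "real (card K) = k" "finite K" by (auto simp: K_def)
  have "c4 K (\<lambda>_. 1 / real k) (D \<omega>) = (\<Sum>y\<in>K. \<Sum>y'\<in>K. \<Sum>x\<in>K. \<Sum>x'\<in>K. (1 / real k) ^ 4 * T y y' x x' \<omega>)" for \<omega>
    by (simp add: c4_def T_def power4_eq_xxxx)
  then have "?E (\<lambda>\<omega>. c4 K (\<lambda>_. 1 / real k) (D \<omega>)) = (\<Sum>y\<in>K. \<Sum>y'\<in>K. \<Sum>x\<in>K. \<Sum>x'\<in>K. (1 / real k) ^ 4 * ?E (T y y' x x'))"
    using integrable_joint[OF G] by (simp add: Bochner_Integration.integral_sum)
  also have "\<dots> \<le> (\<Sum>y\<in>K. \<Sum>y'\<in>K. \<Sum>x\<in>K. \<Sum>x'\<in>K. (1 / real k) ^ 4 * ?b y y' x x')"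
    by (intro sum_mono mult_left_mono bound) auto
  also have "\<dots> = (1 / real k) ^ 4 * (\<Sum>y\<in>K. \<Sum>y'\<in>K. \<Sum>x\<in>K. \<Sum>x'\<in>K. ?b y y' x x')"
    by (simp only: sum_distrib_left)
  \<comment> \<open>Each of the six coincidences leaves \<open>k ^ 3\<close> of the
    \<open>k ^ 4\<close> quadruples.\<close>
  also have "(\<Sum>y\<in>K. \<Sum>y'\<in>K. \<Sum>x\<in>K. \<Sum>x'\<in>K. ?b y y' x x') = real k ^ 4 * C + 6 * real k ^ 3"
    unfolding sum.distrib using cK
    by (simp add: of_bool_def power4_eq_xxxx power3_eq_cube flip: sum_distrib_left)
  also have "(1 / real k) ^ 4 * (real k ^ 4 * C + 6 * real k ^ 3) = C + 6 / k"
    using k by (simp add: field_simps power4_eq_xxxx power3_eq_cube)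
  finally show ?thesis by (simp add: K_def D_def C_def)
qed

text \<open>Variance of an average of \<open>k\<close> independent indicators: after centring, the
  cross terms vanish, and the \<open>k\<close> diagonal terms are at most
  \<open>1 / k\<^sup>2\<close> each.\<close>

lemma expectation_type_count:
  assumes G: "G \<in> weighted_graphs" and k: "k \<ge> 1"
  shows "measure_pmf.expectation (joint_sample k G) (\<lambda>\<omega>.
     (sum (\<lambda>_. 1 / real k) {u\<in>{1..k}. \<tau> (fst \<omega> u) = t} - sum (vprob G) {v\<in>verts G. \<tau> v = t})\<^sup>2) \<le> 1 / k"
proof -
  define w where "w = sum (vprob G) {v\<in>verts G. \<tau> v = t}"
  define d where "d v = of_bool (\<tau> v = t) - w" for v
  define K where "K = {1..k}"
  let ?E = "measure_pmf.expectation (joint_sample k G)"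
  have V: "finite (verts G)" "\<And>v. v \<in> verts G \<Longrightarrow> 0 \<le> vprob G v" "sum (vprob G) (verts G) = 1"
    using prob_weights_vprob[OF G] by (auto simp: prob_weights_def intro: less_imp_le)
  have w: "w = (\<Sum>v\<in>verts G. vprob G v * of_bool (\<tau> v = t))"
    unfolding w_def by (rule sum.mono_neutral_cong_left) (use V in auto)
  have "0 \<le> w" unfolding w_def by (intro sum_nonneg) (use V in auto)
  moreover have "w \<le> sum (vprob G) (verts G)" unfolding w_def by (intro sum_mono2) (use V in auto)
  ultimately have d1: "\<bar>d v\<bar> \<le> 1" for v using V by (auto simp: d_def)
  have d0: "(\<Sum>v\<in>verts G. vprob G v * d v) = 0"
    using V by (simp add: d_def right_diff_distrib sum_subtractf flip: w sum_distrib_right)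
  have dd: "?E (\<lambda>\<omega>. d (fst \<omega> u) * d (fst \<omega> v)) \<le> of_bool (u = v)" if "u \<in> K" "v \<in> K" for u v
  proof (cases "u = v")
    case True
    have "d a * d a \<le> 1" for a using d1[of a] by (simp add: abs_square_le_1 flip: power2_eq_square)
    then have "?E (\<lambda>\<omega>. d (fst \<omega> u) * d (fst \<omega> u)) \<le> 1"
      by (intro expectation_le_1 finite_set_joint G)
    then show ?thesis using True by simp
  next
    case False
    have "?E (\<lambda>\<omega>. d (fst \<omega> u) * d (fst \<omega> v)) = measure_pmf.expectation (sample_vertices k G) (\<lambda>\<Phi>. d (\<Phi> u) * d (\<Phi> v))"
      by (simp add: expectation_joint[OF G])
    also have "\<dots> = (\<Sum>i\<in>verts G. vprob G i * (\<Sum>j\<in>verts G. vprob G j * (d i * d j)))"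
      using that False by (intro expectation_sample_vertices_2[OF G, where F = "\<lambda>i j. d i * d j"]) (auto simp: K_def)
    also have "\<dots> = (\<Sum>i\<in>verts G. vprob G i * d i * (\<Sum>j\<in>verts G. vprob G j * d j))"
      by (simp add: sum_distrib_left mult_ac)
    also have "\<dots> = 0" by (simp add: d0)
    finally show ?thesis by simp
  qed
  have cK: "real (card K) = k" "finite K" by (auto simp: K_def)
  have eq: "sum (\<lambda>_. 1 / real k) {u\<in>K. \<tau> (\<Phi> u) = t} - w = (1 / k) * (\<Sum>u\<in>K. d (\<Phi> u))" for \<Phi>
  proof -
    have "(\<Sum>u\<in>K. d (\<Phi> u)) = real (card {u\<in>K. \<tau> (\<Phi> u) = t}) - k * w"
      using cK by (simp add: d_def sum_subtractf sum.If_cases Int_def of_bool_def)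
    then show ?thesis using k by (simp add: field_simps)
  qed
  have "?E (\<lambda>\<omega>. (sum (\<lambda>_. 1 / real k) {u\<in>K. \<tau> (fst \<omega> u) = t} - w)\<^sup>2)
     = ?E (\<lambda>\<omega>. \<Sum>u\<in>K. \<Sum>v\<in>K. (1 / k)\<^sup>2 * (d (fst \<omega> u) * d (fst \<omega> v)))"
  proof -
    have "((1 / k) * (\<Sum>u\<in>K. d (\<Phi> u)))\<^sup>2 = (\<Sum>u\<in>K. \<Sum>v\<in>K. (1 / k)\<^sup>2 * (d (\<Phi> u) * d (\<Phi> v)))" for \<Phi>
      unfolding power_mult_distrib power2_eq_square[of "\<Sum>u\<in>K. d (\<Phi> u)"] sum_product
      by (simp only: sum_distrib_left)
    then show ?thesis unfolding eq by simp
  qed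
  also have "\<dots> = (\<Sum>u\<in>K. \<Sum>v\<in>K. (1 / k)\<^sup>2 * ?E (\<lambda>\<omega>. d (fst \<omega> u) * d (fst \<omega> v)))"
    using integrable_joint[OF G] by (simp add: Bochner_Integration.integral_sum)
  also have "\<dots> \<le> (\<Sum>u\<in>K. \<Sum>v\<in>K. (1 / k)\<^sup>2 * of_bool (u = v))"
    by (intro sum_mono mult_left_mono dd) auto
  also have "\<dots> = 1 / k"
    using cK k by (simp add: of_bool_def power2_eq_square flip: sum_divide_distrib)
  finally show ?thesis by (simp add: K_def w_def)
qed

text \<open>Markov's inequality for several quantities at once: the indicator of the bad event is
  dominated by the sum \<open>Z\<close> of all quantities, each divided by its admissible value. The
  hypothesis \<open>good\<close> isolates a deterministic claim about a single outcome, so that no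
  probability is left in what follows.\<close>

lemma sample_regular:
  fixes \<tau> :: "nat \<Rightarrow> nat" and M :: nat
  assumes G: "G \<in> weighted_graphs" and k: "k \<ge> 1" and \<kappa>: "\<And>s t. 0 \<le> \<kappa> s t \<and> \<kappa> s t \<le> 1"
    and \<theta>: "0 < \<theta>" and \<delta>: "0 < \<delta>"
    and good: "\<And>\<Phi> E. (\<And>u. u \<in> {1..k} \<Longrightarrow> \<Phi> u \<in> verts G) \<Longrightarrow>
       c4 {1..k} (\<lambda>_. 1 / real k) (\<lambda>u v. eweight (simple_graph k E) u v - \<kappa> (\<tau> (\<Phi> u)) (\<tau> (\<Phi> v))) \<le> \<theta> ^ 4 \<Longrightarrow>
       (\<And>t. t < M \<Longrightarrow> \<bar>sum (\<lambda>_. 1 / real k) {u\<in>{1..k}. \<tau> (\<Phi> u) = t} - sum (vprob G) {v\<in>verts G. \<tau> v = t}\<bar> \<le> \<delta>) \<Longrightarrow>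
       simple_graph k E \<notin> B"
  shows "measure_pmf.prob (sample k G) B \<le>
    (c4 (verts G) (vprob G) (\<lambda>x y. eweight G x y - \<kappa> (\<tau> x) (\<tau> y)) + 6 / k) / \<theta> ^ 4 + M / (k * \<delta>\<^sup>2)"
proof -
  let ?J = "joint_sample k G"
  let ?E = "measure_pmf.expectation ?J"
  define X where "X \<omega> = c4 {1..k} (\<lambda>_. 1 / real k) (sample_deviation k \<tau> \<kappa> \<omega>)" for \<omega>
  define Y where "Y t \<omega> = (sum (\<lambda>_. 1 / real k) {u\<in>{1..k}. \<tau> (fst \<omega> u) = t} - sum (vprob G) {v\<in>verts G. \<tau> v = t})\<^sup>2"
    for t and \<omega> :: "(nat \<Rightarrow> nat) \<times> (nat \<times> nat \<Rightarrow> bool)"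
  define Z where "Z \<omega> = X \<omega> / \<theta> ^ 4 + (\<Sum>t<M. Y t \<omega> / \<delta>\<^sup>2)" for \<omega>
  have X0: "0 \<le> X \<omega>" for \<omega> unfolding X_def by (intro c4_nonneg prob_weights_uniform k)
  have Y0: "0 \<le> Y t \<omega>" for t \<omega> by (simp add: Y_def)
  have YZ: "Y t \<omega> / \<delta>\<^sup>2 \<le> Z \<omega>" if "t < M" for t \<omega>
  proof -
    have "Y t \<omega> / \<delta>\<^sup>2 \<le> (\<Sum>t<M. Y t \<omega> / \<delta>\<^sup>2)"
      using that Y0 by (intro member_le_sum) auto
    then show ?thesis using X0[of \<omega>] by (simp add: Z_def add_increasing)
  qed
  have Z0: "0 \<le> Z \<omega>" for \<omega> unfolding Z_def using X0 Y0 by (intro add_nonneg_nonneg sum_nonneg) auto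
  have bad: "1 \<le> Z (\<Phi>, E)" if "(\<Phi>, E) \<in> set_pmf ?J" "simple_graph k E \<in> B" for \<Phi> E
  proof (rule ccontr)
    assume "\<not> 1 \<le> Z (\<Phi>, E)"
    then have Z1: "Z (\<Phi>, E) < 1" by simp
    have "\<Phi> \<in> set_pmf (sample_vertices k G)" using that(1) by (auto simp: joint_sample_def)
    then have 1: "\<Phi> u \<in> verts G" if "u \<in> {1..k}" for u using set_sample_vertices[OF G] that by blast
    have "X (\<Phi>, E) / \<theta> ^ 4 \<le> Z (\<Phi>, E)" using Y0 by (auto simp: Z_def intro!: sum_nonneg)
    then have "X (\<Phi>, E) / \<theta> ^ 4 \<le> 1" using Z1 by simp
    then have 2: "X (\<Phi>, E) \<le> \<theta> ^ 4" using \<theta> by (simp add: divide_le_eq)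
    have 3: "\<bar>sum (\<lambda>_. 1 / real k) {u\<in>{1..k}. \<tau> (\<Phi> u) = t} - sum (vprob G) {v\<in>verts G. \<tau> v = t}\<bar> \<le> \<delta>"
      if "t < M" for t
    proof -
      have "Y t (\<Phi>, E) / \<delta>\<^sup>2 \<le> 1" using YZ[OF that, of "(\<Phi>, E)"] Z1 by simp
      then have "Y t (\<Phi>, E) \<le> \<delta>\<^sup>2" using \<delta> by (simp add: divide_le_eq)
      then show ?thesis using \<delta> by (simp add: Y_def flip: abs_le_square_iff)
    qed
    show False using good[OF 1 _ 3] 2 that(2) by (simp add: X_def sample_deviation_def)
  qed
  have "measure_pmf.prob (sample k G) B = measure_pmf.prob ?J ((\<lambda>(\<Phi>, E). simple_graph k E) -` B)"
    unfolding sample_eq_joint by simp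
  also have "\<dots> = ?E (indicat_real ((\<lambda>(\<Phi>, E). simple_graph k E) -` B))" by simp
  also have "\<dots> \<le> ?E Z"
  proof (intro integral_mono_AE AE_pmfI integrable_joint G)
    fix \<omega> assume "\<omega> \<in> set_pmf ?J"
    then show "indicat_real ((\<lambda>(\<Phi>, E). simple_graph k E) -` B) \<omega> \<le> Z \<omega>"
      using bad[of "fst \<omega>" "snd \<omega>"] Z0[of \<omega>] by (auto simp: indicator_def split: prod.splits)
  qed
  also have "?E Z = ?E X / \<theta> ^ 4 + (\<Sum>t<M. ?E (Y t) / \<delta>\<^sup>2)"
    unfolding Z_def using integrable_joint[OF G] by (simp add: Bochner_Integration.integral_sum)
  also have "\<dots> \<le> (c4 (verts G) (vprob G) (\<lambda>x y. eweight G x y - \<kappa> (\<tau> x) (\<tau> y)) + 6 / k) / \<theta> ^ 4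
      + (\<Sum>t<M. (1 / k) / \<delta>\<^sup>2)"
    unfolding X_def Y_def
    by (intro add_mono divide_right_mono sum_mono expectation_c4_sample expectation_type_count G k \<kappa>) auto
  finally show ?thesis by simp
qed

section \<open>Transfer of balanced cuts between graphs with a common step kernel\<close>

text \<open>Proportional rescaling moves each entry by the share \<open>x i / s\<close> of the total
  discrepancy, hence by no more than all of it. The purpose is to obtain targets that add up exactly
  to the mass to be divided, as \<open>interval_rounding\<close> requires.\<close>

lemma apportion:
  fixes x :: "nat \<Rightarrow> real"
  assumes "q \<ge> 1" "\<And>i. i \<in> {1..q} \<Longrightarrow> 0 \<le> x i" "0 \<le> w"
  obtains b where "\<And>i. i \<in> {1..q} \<Longrightarrow> 0 \<le> b i" "(\<Sum>i=1..q. b i) = w"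
    "\<And>i. i \<in> {1..q} \<Longrightarrow> \<bar>b i - x i\<bar> \<le> \<bar>w - (\<Sum>i=1..q. x i)\<bar>"
proof (cases "(\<Sum>i=1..q. x i) = 0")
  case True
  then have x0: "x i = 0" if "i \<in> {1..q}" for i
    using assms(2) that by (subst (asm) sum_nonneg_eq_0_iff) auto
  \<comment> \<open>With nothing to rescale the discrepancy is \<open>w\<close> itself, so class 1
    may take everything.\<close>
  show thesis
    by (rule that[of "\<lambda>i. if i = 1 then w else 0"]) (use assms x0 True in auto)
next
  case False
  define s where "s = (\<Sum>i=1..q. x i)"
  have s: "0 < s" using False sum_nonneg[of "{1..q}" x] assms(2) by (auto simp: s_def less_le)
  show thesis
  proof (rule that[of "\<lambda>i. x i * (w / s)"])
    show "(\<Sum>i=1..q. x i * (w / s)) = w"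
      using s by (simp only: sum_distrib_right[symmetric] s_def[symmetric]) simp
    fix i assume i: "i \<in> {1..q}"
    show "0 \<le> x i * (w / s)" using assms i s by auto
    have "x i \<le> s" unfolding s_def using i assms(2) by (intro member_le_sum) auto
    have "x i * (w / s) - x i = (x i / s) * (w - s)" using s by (simp add: field_simps)
    then have "\<bar>x i * (w / s) - x i\<bar> = (x i / s) * \<bar>w - s\<bar>"
      using assms(2)[OF i] s by (simp add: abs_mult)
    also have "\<dots> \<le> 1 * \<bar>w - s\<bar>"
      using \<open>x i \<le> s\<close> s by (intro mult_right_mono) auto
    finally show "\<bar>x i * (w / s) - x i\<bar> \<le> \<bar>w - (\<Sum>i=1..q. x i)\<bar>" by (simp add: s_def)
  qed
qed

lemma sum_by_type:
  fixes \<tau> :: "'a \<Rightarrow> nat"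
  assumes "finite A" "\<And>v. v \<in> A \<Longrightarrow> \<tau> v < M"
  shows "(\<Sum>t<M. sum p {v\<in>A. \<tau> v = t}) = sum p A"
  by (rule sum.group) (use assms in auto)

lemma abs_sum_diff_le:
  fixes p :: "'a \<Rightarrow> real"
  assumes "finite V" "\<And>v. v \<in> V \<Longrightarrow> 0 \<le> p v"
  shows "\<bar>sum p {v\<in>V. P v} - sum p {v\<in>V. Q v}\<bar> \<le> sum p {v\<in>V. P v \<noteq> Q v}"
proof -
  have e: "sum p {v\<in>V. R v} = (\<Sum>v\<in>V. p v * of_bool (R v))" for R
    by (rule sum.mono_neutral_cong_left) (use assms in auto)
  show ?thesis unfolding e sum_subtractf[symmetric]
    by (rule order_trans[OF sum_abs]) (intro sum_mono, use assms in auto)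
qed

text \<open>Two roundings. Inside each type the vertices of \<open>V2\<close> are divided in the
  proportions of \<open>f1\<close>; this gives the right profile, but class weights that collect an
  error from each of the \<open>M\<close> types. A second rounding of all of \<open>V2\<close>
  towards \<open>a\<close> restores the tolerance \<open>\<sigma>\<close> of \<open>V2\<close>. It
  starts from the first one, so it moves little mass and spoils the profile little.
  \<open>\<sigma>\<close> is kept apart from the common bound \<open>\<rho>\<close> because the
  result must meet the tolerance of \<open>V2\<close> itself.\<close>

lemma transfer_partition:
  fixes p1 p2 a :: "nat \<Rightarrow> real" and \<tau>1 \<tau>2 f1 :: "nat \<Rightarrow> nat" and M q :: nat and \<rho> \<sigma> \<delta> :: real
  assumes V1: "prob_weights V1 p1" and V2: "prob_weights V2 p2"
    and small: "\<And>v. v \<in> V2 \<Longrightarrow> p2 v \<le> \<sigma>" and sigma: "0 \<le> \<sigma>" "\<sigma> \<le> \<rho>"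
    and t1: "\<And>v. v \<in> V1 \<Longrightarrow> \<tau>1 v < M" and t2: "\<And>v. v \<in> V2 \<Longrightarrow> \<tau>2 v < M"
    and close: "\<And>t. t < M \<Longrightarrow> \<bar>sum p1 {v\<in>V1. \<tau>1 v = t} - sum p2 {v\<in>V2. \<tau>2 v = t}\<bar> \<le> \<delta>"
    and f1: "\<And>v. v \<in> V1 \<Longrightarrow> f1 v \<in> {1..q}"
    and bal: "\<And>i. i \<in> {1..q} \<Longrightarrow> \<bar>sum p1 {v\<in>V1. f1 v = i} - a i\<bar> \<le> \<rho>"
    and a: "\<And>i. i \<in> {1..q} \<Longrightarrow> 0 \<le> a i" "(\<Sum>i=1..q. a i) = 1" and q: "q \<ge> 1"
  obtains f2 where "\<forall>v\<in>V2. f2 v \<in> {1..q}"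
    and "\<forall>i\<in>{1..q}. \<bar>sum p2 {v\<in>V2. f2 v = i} - a i\<bar> \<le> \<sigma>"
    and "\<forall>i\<in>{1..q}. \<forall>t<M.
      \<bar>sum p1 {v\<in>V1. f1 v = i \<and> \<tau>1 v = t} - sum p2 {v\<in>V2. f2 v = i \<and> \<tau>2 v = t}\<bar>
       \<le> \<rho> + \<delta> + q * (q * (M * (\<rho> + \<delta>) + \<rho>) + \<rho>)"
proof -
  have fin: "finite V1" "finite V2" and pos: "\<And>v. v \<in> V1 \<Longrightarrow> 0 < p1 v" "\<And>v. v \<in> V2 \<Longrightarrow> 0 < p2 v"
    and one: "sum p2 V2 = 1" using V1 V2 by (auto simp: prob_weights_def)
  have rho: "0 \<le> \<rho>" using sigma by simp
  have pos': "0 \<le> p1 v" if "v \<in> V1" for v using pos(1)[OF that] by simp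
  have pos2': "0 \<le> p2 v" if "v \<in> V2" for v using pos(2)[OF that] by simp
  define x where "x t i = sum p1 {v\<in>V1. f1 v = i \<and> \<tau>1 v = t}" for t i
  have xs: "(\<Sum>i=1..q. x t i) = sum p1 {v\<in>V1. \<tau>1 v = t}" for t
  proof -
    have "(\<Sum>i=1..q. sum p1 {v\<in>{v\<in>V1. \<tau>1 v = t}. f1 v = i}) = sum p1 {v\<in>V1. \<tau>1 v = t}"
      by (rule sum.group) (use fin f1 in auto)
    moreover have "{v\<in>{v\<in>V1. \<tau>1 v = t}. f1 v = i} = {v\<in>V1. f1 v = i \<and> \<tau>1 v = t}" for i by auto
    ultimately show ?thesis by (simp add: x_def)
  qed
  define good where "good t g \<longleftrightarrow> (\<forall>v\<in>V2. \<tau>2 v = t \<longrightarrow> g v \<in> {1..q}) \<and>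
     (\<forall>i\<in>{1..q}. \<bar>x t i - sum p2 {v\<in>V2. g v = i \<and> \<tau>2 v = t}\<bar> \<le> \<rho> + \<delta>)" for t g
  have "\<exists>g. good t g" if t: "t < M" for t
  proof -
    define X where "X = {v\<in>V2. \<tau>2 v = t}"
    have "0 \<le> sum p2 X" unfolding X_def by (intro sum_nonneg) (auto intro: pos2')
    moreover have "0 \<le> x t i" for i unfolding x_def by (intro sum_nonneg) (auto intro: pos')
    ultimately obtain b where b: "\<And>i. i \<in> {1..q} \<Longrightarrow> 0 \<le> b i" "(\<Sum>i=1..q. b i) = sum p2 X"
      "\<And>i. i \<in> {1..q} \<Longrightarrow> \<bar>b i - x t i\<bar> \<le> \<bar>sum p2 X - (\<Sum>i=1..q. x t i)\<bar>"
      using apportion[OF q, of "x t" "sum p2 X"] by blast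
    have X: "finite X" "\<And>v. v \<in> X \<Longrightarrow> 0 < p2 v" "\<And>v. v \<in> X \<Longrightarrow> p2 v \<le> \<rho>" "\<And>v. v \<in> X \<Longrightarrow> 1 \<in> {1..q}"
      using fin pos order_trans[OF small sigma(2)] q by (auto simp: X_def)
    \<comment> \<open>Only the class masses matter within one type, so a constant reference map will
      do.\<close>
    obtain g where g0: "\<forall>v\<in>X. g v \<in> {1..q}" "\<forall>i\<in>{1..q}. \<bar>sum p2 {v\<in>X. g v = i} - b i\<bar> \<le> \<rho>"
      by (rule interval_rounding[where g = "\<lambda>_. 1", OF X(1-3) rho X(4) b(1,2)])
    note g = g0[rule_format]
    have "\<bar>x t i - sum p2 {v\<in>V2. g v = i \<and> \<tau>2 v = t}\<bar> \<le> \<rho> + \<delta>" if i: "i \<in> {1..q}" for i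
    proof -
      have "{v\<in>V2. g v = i \<and> \<tau>2 v = t} = {v\<in>X. g v = i}" by (auto simp: X_def)
      moreover have "\<bar>b i - x t i\<bar> \<le> \<delta>" using b(3)[OF i] close[OF t] unfolding xs X_def by linarith
      ultimately show ?thesis using g(2)[OF i] by simp
    qed
    moreover have "\<forall>v\<in>V2. \<tau>2 v = t \<longrightarrow> g v \<in> {1..q}" using g(1) unfolding X_def by blast
    ultimately show ?thesis unfolding good_def by blast
  qed
  then obtain gg where gg: "\<And>t. t < M \<Longrightarrow> good t (gg t)" by metis
  define g where "g v = gg (\<tau>2 v) v" for v
  have g1: "g v \<in> {1..q}" if "v \<in> V2" for v using gg[OF t2[OF that]] that unfolding good_def g_def by blast
  have g2: "\<bar>x t i - sum p2 {v\<in>V2. g v = i \<and> \<tau>2 v = t}\<bar> \<le> \<rho> + \<delta>" if "t < M" "i \<in> {1..q}" for t i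
  proof -
    have "{v\<in>V2. g v = i \<and> \<tau>2 v = t} = {v\<in>V2. gg t v = i \<and> \<tau>2 v = t}" by (auto simp: g_def)
    then show ?thesis using gg[OF that(1)] that(2) unfolding good_def by simp
  qed
  \<comment> \<open>An error \<open>\<rho> + \<delta>\<close> from each of the \<open>M\<close>
    types, and \<open>\<rho>\<close> from the imbalance of \<open>f1\<close>.\<close>
  have g3: "\<bar>a i - sum p2 {v\<in>V2. g v = i}\<bar> \<le> M * (\<rho> + \<delta>) + \<rho>" if i: "i \<in> {1..q}" for i
  proof -
    have "sum p1 {v\<in>V1. f1 v = i} = (\<Sum>t<M. x t i)"
      unfolding x_def using sum_by_type[of "{v\<in>V1. f1 v = i}" \<tau>1 M p1] fin t1 by simp
    moreover have "sum p2 {v\<in>V2. g v = i} = (\<Sum>t<M. sum p2 {v\<in>V2. g v = i \<and> \<tau>2 v = t})"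
      using sum_by_type[of "{v\<in>V2. g v = i}" \<tau>2 M p2] fin t2 by simp
    ultimately have "\<bar>sum p1 {v\<in>V1. f1 v = i} - sum p2 {v\<in>V2. g v = i}\<bar>
       \<le> (\<Sum>t<M. \<bar>x t i - sum p2 {v\<in>V2. g v = i \<and> \<tau>2 v = t}\<bar>)"
      by (simp only: sum_subtractf[symmetric] sum_abs)
    also have "\<dots> \<le> (\<Sum>t<M. \<rho> + \<delta>)" by (intro sum_mono g2 i) auto
    finally show ?thesis using bal[OF i] by simp
  qed
  have a1: "(\<Sum>i=1..q. a i) = sum p2 V2" using a one by simp
  obtain f where f: "\<forall>v\<in>V2. f v \<in> {1..q}"
     "\<forall>i\<in>{1..q}. \<bar>sum p2 {v\<in>V2. f v = i} - a i\<bar> \<le> \<sigma>"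
     "sum p2 {v\<in>V2. f v \<noteq> g v} \<le> q * ((\<Sum>j=1..q. \<bar>a j - sum p2 {v\<in>V2. g v = j}\<bar>) + \<sigma>)"
    by (rule interval_rounding[OF fin(2) pos(2) small sigma(1) g1 a(1) a1])
  have "(\<Sum>j=1..q. \<bar>a j - sum p2 {v\<in>V2. g v = j}\<bar>) \<le> (\<Sum>j=1..q. M * (\<rho> + \<delta>) + \<rho>)"
    by (intro sum_mono g3)
  then have D: "sum p2 {v\<in>V2. f v \<noteq> g v} \<le> q * (q * (M * (\<rho> + \<delta>) + \<rho>) + \<rho>)"
    using sigma by (intro order_trans[OF f(3)] mult_left_mono add_mono) auto
  show thesis
  proof (rule that[OF f(1,2)], intro ballI allI impI)
    fix i t assume it: "i \<in> {1..q}" "t < M"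
    have "\<bar>sum p2 {v\<in>V2. f v = i \<and> \<tau>2 v = t} - sum p2 {v\<in>V2. g v = i \<and> \<tau>2 v = t}\<bar>
      \<le> sum p2 {v\<in>V2. (f v = i \<and> \<tau>2 v = t) \<noteq> (g v = i \<and> \<tau>2 v = t)}"
      by (rule abs_sum_diff_le[OF fin(2) pos2'])
    also have "\<dots> \<le> sum p2 {v\<in>V2. f v \<noteq> g v}"
      by (intro sum_mono2) (use fin pos2' in auto)
    finally show "\<bar>sum p1 {v\<in>V1. f1 v = i \<and> \<tau>1 v = t} - sum p2 {v\<in>V2. f v = i \<and> \<tau>2 v = t}\<bar>
       \<le> \<rho> + \<delta> + q * (q * (M * (\<rho> + \<delta>) + \<rho>) + \<rho>)"
      using D g2[OF it(2,1)] unfolding x_def by linarith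
  qed
qed

text \<open>A step kernel does not distinguish vertices of the same type, so its cut sums are
  bilinear in the type masses of the two sets. This is why the mass of each type in each class
  describes a partition well enough.\<close>

lemma cut_sum_step_kernel:
  fixes \<tau> :: "nat \<Rightarrow> nat"
  assumes "finite A" "finite B" "\<And>v. v \<in> A \<Longrightarrow> \<tau> v < M" "\<And>v. v \<in> B \<Longrightarrow> \<tau> v < M"
  shows "cut_sum p (\<lambda>x y. \<kappa> (\<tau> x) (\<tau> y)) A B =
    (\<Sum>s<M. \<Sum>t<M. \<kappa> s t * (sum p {v\<in>A. \<tau> v = s} * sum p {v\<in>B. \<tau> v = t}))"
proof -
  have "cut_sum p (\<lambda>x y. \<kappa> (\<tau> x) (\<tau> y)) A B =
     (\<Sum>x\<in>A. (\<Sum>t<M. sum (\<lambda>y. p x * p y * \<kappa> (\<tau> x) (\<tau> y)) {v\<in>B. \<tau> v = t}))"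
    unfolding cut_sum_def by (intro sum.cong refl sum_by_type[symmetric]) (use assms in auto)
  also have "\<dots> = (\<Sum>x\<in>A. p x * (\<Sum>t<M. \<kappa> (\<tau> x) t * sum p {v\<in>B. \<tau> v = t}))"
    by (simp add: sum_distrib_left mult_ac)
  also have "\<dots> = (\<Sum>s<M. sum (\<lambda>x. p x * (\<Sum>t<M. \<kappa> (\<tau> x) t * sum p {v\<in>B. \<tau> v = t})) {v\<in>A. \<tau> v = s})"
    by (intro sum_by_type[symmetric]) (use assms in auto)
  also have "\<dots> = (\<Sum>s<M. sum p {v\<in>A. \<tau> v = s} * (\<Sum>t<M. \<kappa> s t * sum p {v\<in>B. \<tau> v = t}))"
    by (simp add: sum_distrib_right)
  also have "\<dots> = (\<Sum>s<M. \<Sum>t<M. \<kappa> s t * (sum p {v\<in>A. \<tau> v = s} * sum p {v\<in>B. \<tau> v = t}))"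
    by (simp add: sum_distrib_left mult_ac)
  finally show ?thesis .
qed

text \<open>The first quotient is at most 1, so the change of the denominator, at most
  \<open>2 * r\<close>, enters with weight at most 1; the second denominator is at least
  \<open>c\<^sup>2\<close>.\<close>

lemma quotient_close:
  fixes c :: real
  assumes c: "0 < c" and b: "c \<le> P1" "c \<le> Q1" "c \<le> P2" "c \<le> Q2" "P1 \<le> 1" "Q1 \<le> 1" "P2 \<le> 1" "Q2 \<le> 1"
    and e: "0 \<le> e1" "e1 \<le> P1 * Q1" "\<bar>e1 - e2\<bar> \<le> \<epsilon>" and r: "\<bar>P1 - P2\<bar> \<le> r" "\<bar>Q1 - Q2\<bar> \<le> r"
  shows "\<bar>e1 / (P1 * Q1) - e2 / (P2 * Q2)\<bar> \<le> (\<epsilon> + 2 * r) / c\<^sup>2"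
proof -
  have pos: "0 < P1" "0 < Q1" "0 < P2" "0 < Q2" using c b by auto
  have "P2 * Q2 - P1 * Q1 = (P2 - P1) * Q2 + P1 * (Q2 - Q1)" by (simp add: algebra_simps)
  then have "\<bar>P2 * Q2 - P1 * Q1\<bar> \<le> \<bar>P2 - P1\<bar> * Q2 + P1 * \<bar>Q2 - Q1\<bar>"
    using abs_triangle_ineq[of "(P2 - P1) * Q2" "P1 * (Q2 - Q1)"] pos by (simp add: abs_mult)
  also have "\<dots> \<le> r * 1 + 1 * r"
    using r b pos by (intro add_mono mult_mono) auto
  finally have d: "\<bar>P2 * Q2 - P1 * Q1\<bar> \<le> 2 * r" by simp
  have cc: "c\<^sup>2 \<le> P2 * Q2" unfolding power2_eq_square using b c by (intro mult_mono) auto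
  have "e1 / (P1 * Q1) - e2 / (P2 * Q2) = ((e1 - e2) + (e1 / (P1 * Q1)) * (P2 * Q2 - P1 * Q1)) / (P2 * Q2)"
    using pos by (simp add: field_simps)
  then have "\<bar>e1 / (P1 * Q1) - e2 / (P2 * Q2)\<bar> = \<bar>(e1 - e2) + (e1 / (P1 * Q1)) * (P2 * Q2 - P1 * Q1)\<bar> / (P2 * Q2)"
    using pos by (simp add: abs_divide)
  also have "\<dots> \<le> (\<bar>e1 - e2\<bar> + (e1 / (P1 * Q1)) * \<bar>P2 * Q2 - P1 * Q1\<bar>) / (P2 * Q2)"
    using abs_triangle_ineq[of "e1 - e2" "(e1 / (P1 * Q1)) * (P2 * Q2 - P1 * Q1)"] pos e(1)
    by (intro divide_right_mono) (auto simp: abs_mult)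
  also have "\<dots> \<le> (\<epsilon> + 1 * (2 * r)) / c\<^sup>2"
    using e d pos cc c by (intro frac_le add_mono mult_mono) auto
  finally show ?thesis by simp
qed

text \<open>A partition is given by its class map, so disjointness is automatic and covering is a
  condition on the range of \<open>f\<close>; only the balance has to be arranged.\<close>

definition cut_density :: "nat \<Rightarrow> nat set \<Rightarrow> (nat \<Rightarrow> real) \<Rightarrow> (nat \<Rightarrow> nat \<Rightarrow> real) \<Rightarrow> (nat \<Rightarrow> nat) \<Rightarrow> real" where
  "cut_density q V p W f = (\<Sum>i=1..q-1. \<Sum>j=i+1..q. cut_sum p W {v\<in>V. f v = i} {v\<in>V. f v = j} /
     (sum p {v\<in>V. f v = i} * sum p {v\<in>V. f v = j}))"

text \<open>For each pair of classes, \<open>2 * \<theta>\<close> pays for replacing both kernels by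
  the step kernel, \<open>2 * D\<close> for each of the \<open>M\<^sup>2\<close> pairs of types, and
  \<open>4 * \<rho>\<close> for the denominators, since class weights near the same
  \<open>a i\<close> differ by at most \<open>2 * \<rho>\<close>. There are at most
  \<open>q * q\<close> pairs of classes.\<close>

lemma cut_density_transfer:
  fixes p1 p2 a :: "nat \<Rightarrow> real" and \<tau>1 \<tau>2 f1 :: "nat \<Rightarrow> nat" and M q :: nat and \<rho> \<sigma> \<delta> D :: real
  assumes V1: "prob_weights V1 p1" and V2: "prob_weights V2 p2"
    and small: "\<And>v. v \<in> V2 \<Longrightarrow> p2 v \<le> \<sigma>" and sigma: "0 \<le> \<sigma>" "\<sigma> \<le> \<rho>"
    and t1: "\<And>v. v \<in> V1 \<Longrightarrow> \<tau>1 v < M" and t2: "\<And>v. v \<in> V2 \<Longrightarrow> \<tau>2 v < M"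
    and close: "\<And>t. t < M \<Longrightarrow> \<bar>sum p1 {v\<in>V1. \<tau>1 v = t} - sum p2 {v\<in>V2. \<tau>2 v = t}\<bar> \<le> \<delta>"
    and f1: "\<And>v. v \<in> V1 \<Longrightarrow> f1 v \<in> {1..q}"
    and bal: "\<And>i. i \<in> {1..q} \<Longrightarrow> \<bar>sum p1 {v\<in>V1. f1 v = i} - a i\<bar> \<le> \<rho>"
    and a: "\<And>i. i \<in> {1..q} \<Longrightarrow> 0 \<le> a i" "(\<Sum>i=1..q. a i) = 1" and q: "q \<ge> 1"
    and c: "0 < c" "\<And>i. i \<in> {1..q} \<Longrightarrow> c + \<rho> \<le> a i"
    and W1: "\<And>x y. x \<in> V1 \<Longrightarrow> y \<in> V1 \<Longrightarrow> 0 \<le> W1 x y \<and> W1 x y \<le> 1"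
    and \<kappa>: "\<And>s t. 0 \<le> \<kappa> s t \<and> \<kappa> s t \<le> 1"
    and cut1: "\<And>S T. S \<subseteq> V1 \<Longrightarrow> T \<subseteq> V1 \<Longrightarrow> \<bar>cut_sum p1 (\<lambda>x y. W1 x y - \<kappa> (\<tau>1 x) (\<tau>1 y)) S T\<bar> \<le> \<theta>"
    and cut2: "\<And>S T. S \<subseteq> V2 \<Longrightarrow> T \<subseteq> V2 \<Longrightarrow> \<bar>cut_sum p2 (\<lambda>x y. W2 x y - \<kappa> (\<tau>2 x) (\<tau>2 y)) S T\<bar> \<le> \<theta>"
    and D: "\<rho> + \<delta> + q * (q * (M * (\<rho> + \<delta>) + \<rho>) + \<rho>) \<le> D"
  obtains f2 where "\<forall>v\<in>V2. f2 v \<in> {1..q}"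
    and "\<forall>i\<in>{1..q}. \<bar>sum p2 {v\<in>V2. f2 v = i} - a i\<bar> \<le> \<sigma>"
    and "cut_density q V2 p2 W2 f2 \<le> cut_density q V1 p1 W1 f1 + q * (q * ((2 * \<theta> + 2 * M\<^sup>2 * D + 4 * \<rho>) / c\<^sup>2))"
proof -
  have fin: "finite V1" "finite V2" and pos1: "\<And>v. v \<in> V1 \<Longrightarrow> 0 \<le> p1 v" and pos2: "\<And>v. v \<in> V2 \<Longrightarrow> 0 \<le> p2 v"
    and one: "sum p1 V1 = 1" "sum p2 V2 = 1" using V1 V2 by (auto simp: prob_weights_def intro: less_imp_le)
  have sub1: "0 \<le> sum p1 {v\<in>V1. P v} \<and> sum p1 {v\<in>V1. P v} \<le> 1" for P
    using fin pos1 one(1) sum_mono2[of V1 "{v\<in>V1. P v}" p1] by (auto intro!: sum_nonneg)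
  have sub2: "0 \<le> sum p2 {v\<in>V2. P v} \<and> sum p2 {v\<in>V2. P v} \<le> 1" for P
    using fin pos2 one(2) sum_mono2[of V2 "{v\<in>V2. P v}" p2] by (auto intro!: sum_nonneg)
  obtain f2 where f2: "\<forall>v\<in>V2. f2 v \<in> {1..q}"
    and bal2: "\<forall>i\<in>{1..q}. \<bar>sum p2 {v\<in>V2. f2 v = i} - a i\<bar> \<le> \<sigma>"
    and masses: "\<forall>i\<in>{1..q}. \<forall>t<M.
      \<bar>sum p1 {v\<in>V1. f1 v = i \<and> \<tau>1 v = t} - sum p2 {v\<in>V2. f2 v = i \<and> \<tau>2 v = t}\<bar>
       \<le> \<rho> + \<delta> + q * (q * (M * (\<rho> + \<delta>) + \<rho>) + \<rho>)"
    by (rule transfer_partition[where ?p1.0 = p1 and ?p2.0 = p2 and a = a and ?\<tau>1.0 = \<tau>1 and ?\<tau>2.0 = \<tau>2 and ?f1.0 = f1,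
       OF V1 V2 small sigma t1 t2 close f1 bal a q])
  define x where "x t i = sum p1 {v\<in>V1. f1 v = i \<and> \<tau>1 v = t}" for t i
  define y where "y t i = sum p2 {v\<in>V2. f2 v = i \<and> \<tau>2 v = t}" for t i
  have xy: "\<bar>x t i - y t i\<bar> \<le> D" if "i \<in> {1..q}" "t < M" for t i
    using masses[rule_format, OF that] D by (simp add: x_def y_def)
  have cutdiff: "cut_sum p (\<lambda>x y. W x y - K x y) A B = cut_sum p W A B - cut_sum p K A B" for p W K A B
    by (simp add: cut_sum_def right_diff_distrib sum_subtractf)
  let ?E = "2 * \<theta> + 2 * M\<^sup>2 * D"
  have ij: "\<bar>cut_sum p1 W1 {v\<in>V1. f1 v = i} {v\<in>V1. f1 v = j} / (sum p1 {v\<in>V1. f1 v = i} * sum p1 {v\<in>V1. f1 v = j}) -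
      cut_sum p2 W2 {v\<in>V2. f2 v = i} {v\<in>V2. f2 v = j} / (sum p2 {v\<in>V2. f2 v = i} * sum p2 {v\<in>V2. f2 v = j})\<bar>
     \<le> (?E + 2 * (2 * \<rho>)) / c\<^sup>2" if i: "i \<in> {1..q}" and j: "j \<in> {1..q}" for i j
  proof (rule quotient_close[OF c(1)])
    let ?A1 = "{v\<in>V1. f1 v = i}" and ?B1 = "{v\<in>V1. f1 v = j}" and ?A2 = "{v\<in>V2. f2 v = i}" and ?B2 = "{v\<in>V2. f2 v = j}"
    show "c \<le> sum p1 ?A1" "c \<le> sum p1 ?B1" using bal[OF i] bal[OF j] c(2)[OF i] c(2)[OF j] by auto
    show "c \<le> sum p2 ?A2" "c \<le> sum p2 ?B2" using bal2[rule_format, OF i] bal2[rule_format, OF j] c(2)[OF i] c(2)[OF j] sigma by auto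
    show "sum p1 ?A1 \<le> 1" "sum p1 ?B1 \<le> 1" "sum p2 ?A2 \<le> 1" "sum p2 ?B2 \<le> 1" using sub1 sub2 by auto
    show "\<bar>sum p1 ?A1 - sum p2 ?A2\<bar> \<le> 2 * \<rho>" "\<bar>sum p1 ?B1 - sum p2 ?B2\<bar> \<le> 2 * \<rho>"
      using bal[OF i] bal[OF j] bal2[rule_format, OF i] bal2[rule_format, OF j] sigma by auto
    show "0 \<le> cut_sum p1 W1 ?A1 ?B1"
      unfolding cut_sum_def using W1 pos1 by (intro sum_nonneg mult_nonneg_nonneg) auto
    have "cut_sum p1 W1 ?A1 ?B1 \<le> (\<Sum>s\<in>?A1. \<Sum>t\<in>?B1. p1 s * p1 t)"
      unfolding cut_sum_def using W1 pos1 by (intro sum_mono mult_right_le_one_le mult_nonneg_nonneg) auto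
    then show "cut_sum p1 W1 ?A1 ?B1 \<le> sum p1 ?A1 * sum p1 ?B1" by (simp add: sum_product)
    have k1: "cut_sum p1 (\<lambda>x y. \<kappa> (\<tau>1 x) (\<tau>1 y)) ?A1 ?B1 = (\<Sum>s<M. \<Sum>t<M. \<kappa> s t * (x s i * x t j))"
      using fin t1 by (subst cut_sum_step_kernel[where M = M]) (auto simp: x_def)
    have k2: "cut_sum p2 (\<lambda>x y. \<kappa> (\<tau>2 x) (\<tau>2 y)) ?A2 ?B2 = (\<Sum>s<M. \<Sum>t<M. \<kappa> s t * (y s i * y t j))"
      using fin t2 by (subst cut_sum_step_kernel[where M = M]) (auto simp: y_def)
    have "\<bar>(\<Sum>s<M. \<Sum>t<M. \<kappa> s t * (x s i * x t j)) - (\<Sum>s<M. \<Sum>t<M. \<kappa> s t * (y s i * y t j))\<bar>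
      \<le> (\<Sum>s<M. \<Sum>t<M. \<bar>\<kappa> s t * (x s i * x t j) - \<kappa> s t * (y s i * y t j)\<bar>)"
      unfolding sum_subtractf[symmetric]
      by (rule order_trans[OF sum_abs], rule sum_mono, rule sum_abs)
    also have "\<dots> \<le> (\<Sum>s<M. \<Sum>t<M. 2 * D)"
    proof (intro sum_mono)
      fix s t assume st: "s \<in> {..<M}" "t \<in> {..<M}"
      have "x s i * x t j - y s i * y t j = (x s i - y s i) * x t j + y s i * (x t j - y t j)"
        by (simp add: algebra_simps)
      then have "\<bar>x s i * x t j - y s i * y t j\<bar> \<le> \<bar>x s i - y s i\<bar> * \<bar>x t j\<bar> + \<bar>y s i\<bar> * \<bar>x t j - y t j\<bar>"
        by (metis abs_mult abs_triangle_ineq)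
      also have "\<dots> \<le> D * 1 + 1 * D"
        using xy[OF i] xy[OF j] st sub1 sub2
        by (intro add_mono mult_mono) (auto simp: x_def y_def intro: order_trans[OF abs_ge_zero])
      finally have "\<bar>x s i * x t j - y s i * y t j\<bar> \<le> 2 * D" by simp
      moreover have "\<bar>\<kappa> s t * (x s i * x t j) - \<kappa> s t * (y s i * y t j)\<bar> = \<kappa> s t * \<bar>x s i * x t j - y s i * y t j\<bar>"
        using \<kappa> by (simp add: abs_mult flip: right_diff_distrib)
      moreover have "\<kappa> s t * \<bar>x s i * x t j - y s i * y t j\<bar> \<le> \<bar>x s i * x t j - y s i * y t j\<bar>"
        using \<kappa> by (intro mult_left_le_one_le) auto
      ultimately show "\<bar>\<kappa> s t * (x s i * x t j) - \<kappa> s t * (y s i * y t j)\<bar> \<le> 2 * D" by linarith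
    qed
    also have "\<dots> = 2 * M\<^sup>2 * D" by (simp add: power2_eq_square)
    finally have "\<bar>cut_sum p1 (\<lambda>x y. \<kappa> (\<tau>1 x) (\<tau>1 y)) ?A1 ?B1 - cut_sum p2 (\<lambda>x y. \<kappa> (\<tau>2 x) (\<tau>2 y)) ?A2 ?B2\<bar> \<le> 2 * M\<^sup>2 * D"
      by (simp only: k1 k2)
    then show "\<bar>cut_sum p1 W1 ?A1 ?B1 - cut_sum p2 W2 ?A2 ?B2\<bar> \<le> ?E"
      using cut1[of ?A1 ?B1] cut2[of ?A2 ?B2] unfolding cutdiff by auto
  qed
  let ?F = "(2 * \<theta> + 2 * M\<^sup>2 * D + 4 * \<rho>) / c\<^sup>2"
  \<comment> \<open>A bound on an absolute value is nonnegative; this allows enlarging the sum to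
    all \<open>q * q\<close> index pairs.\<close>
  have F0: "0 \<le> ?F" using order_trans[OF abs_ge_zero ij[of 1 1]] q by simp
  define d1 where "d1 i j = cut_sum p1 W1 {v\<in>V1. f1 v = i} {v\<in>V1. f1 v = j} / (sum p1 {v\<in>V1. f1 v = i} * sum p1 {v\<in>V1. f1 v = j})" for i j
  define d2 where "d2 i j = cut_sum p2 W2 {v\<in>V2. f2 v = i} {v\<in>V2. f2 v = j} / (sum p2 {v\<in>V2. f2 v = i} * sum p2 {v\<in>V2. f2 v = j})" for i j
  have d: "d2 i j \<le> d1 i j + ?F" if "i \<in> {1..q}" "j \<in> {1..q}" for i j
    using ij[OF that] unfolding d1_def[symmetric] d2_def[symmetric] by auto
  have "cut_density q V2 p2 W2 f2 = (\<Sum>i=1..q-1. \<Sum>j=i+1..q. d2 i j)" by (simp add: cut_density_def d2_def)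
  also have "\<dots> \<le> (\<Sum>i=1..q-1. \<Sum>j=i+1..q. d1 i j + ?F)" by (intro sum_mono d) auto
  also have "\<dots> = cut_density q V1 p1 W1 f1 + (\<Sum>i=1..q-1. \<Sum>j=i+1..q. ?F)"
    by (simp only: sum.distrib cut_density_def d1_def)
  also have "(\<Sum>i=1..q-1. \<Sum>j=i+1..q. ?F) \<le> (\<Sum>i=1..q. \<Sum>j=1..q. ?F)"
  proof (rule order_trans[OF sum_mono])
    show "(\<Sum>j=i+1..q. ?F) \<le> (\<Sum>j=1..q. ?F)" for i by (intro sum_mono2) (use F0 in auto)
    show "(\<Sum>i=1..q-1. \<Sum>j=1..q. ?F) \<le> (\<Sum>i=1..q. \<Sum>j=1..q. ?F)"
      by (intro sum_mono2 sum_nonneg) (use F0 in auto)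
  qed
  also have "(\<Sum>i=1..q. \<Sum>j=1..q. ?F) = q * (q * ?F)" by simp
  finally show thesis using that[OF f2 bal2] by simp
qed

section \<open>The minimum cut density\<close>

lemma isomorphic_sym:
  assumes "isomorphic G H"
  shows "isomorphic H G"
proof -
  obtain p where p: "bij_betw p (verts G) (verts H)"
    "\<And>i. i \<in> verts G \<Longrightarrow> vweight H (p i) = vweight G i"
    "\<And>i j. i \<in> verts G \<Longrightarrow> j \<in> verts G \<Longrightarrow> eweight H (p i) (p j) = eweight G i j"
    using assms by (auto simp: isomorphic_def)
  define r where "r = inv_into (verts G) p"
  have r: "r i \<in> verts G" "p (r i) = i" if "i \<in> verts H" for i
    using p(1) that unfolding r_def bij_betw_def by (auto intro: inv_into_into f_inv_into_f)
  show ?thesis unfolding isomorphic_def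
  proof (intro exI[of _ r] conjI ballI)
    show "bij_betw r (verts H) (verts G)" unfolding r_def by (rule bij_betw_inv_into[OF p(1)])
    show "vweight G (r i) = vweight H i" if "i \<in> verts H" for i using p(2)[of "r i"] r[OF that] by simp
    show "eweight G (r i) (r j) = eweight H i j" if "i \<in> verts H" "j \<in> verts H" for i j
      using p(3)[of "r i" "r j"] r[OF that(1)] r[OF that(2)] by simp
  qed
qed

text \<open>Partitions are pushed forward along the isomorphism. One inclusion is enough, since
  \<open>isomorphic_sym\<close> supplies the other.\<close>

lemma isomorphic_cut_densities:
  assumes "isomorphic G H"
  shows "weighted_cut_density q G ` balanced_partitions q a G \<subseteq> weighted_cut_density q H ` balanced_partitions q a H"
proof
  fix z assume "z \<in> weighted_cut_density q G ` balanced_partitions q a G"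
  then obtain V where V: "V \<in> balanced_partitions q a G" "z = weighted_cut_density q G V" by auto
  obtain p where p: "bij_betw p (verts G) (verts H)"
    "\<And>i. i \<in> verts G \<Longrightarrow> vweight H (p i) = vweight G i"
    "\<And>i j. i \<in> verts G \<Longrightarrow> j \<in> verts G \<Longrightarrow> eweight H (p i) (p j) = eweight G i j"
    using assms by (auto simp: isomorphic_def)
  have inj: "inj_on p (verts G)" and im: "p ` verts G = verts H" using p(1) by (auto simp: bij_betw_def)
  have inj': "inj_on p S" if "S \<subseteq> verts G" for S using inj that by (rule inj_on_subset)
  have w: "weight H (p ` S) = weight G S" if "S \<subseteq> verts G" for S
    unfolding weight_def using p(2) that by (subst sum.reindex[OF inj'[OF that]]) (auto intro!: sum.cong)
  have tot: "total_weight H = total_weight G" using w[of "verts G"] by (simp add: total_weight_def im)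
  have "vweight H ` verts H = vweight G ` verts G" using p(2) unfolding im[symmetric] by (auto simp: image_iff)
  then have mx: "max_weight H = max_weight G" by (simp add: max_weight_def)
  have em: "edge_mass H (p ` S) (p ` T) = edge_mass G S T" if "S \<subseteq> verts G" "T \<subseteq> verts G" for S T
    unfolding edge_mass_def
    apply (subst sum.reindex[OF inj'[OF that(1)]])
    apply (subst sum.reindex[OF inj'[OF that(2)]])
    using p(2,3) that by (auto intro!: sum.cong simp: subset_iff)
  define V' where "V' = (\<lambda>i\<in>{1..q}. p ` V i)"
  have sub: "V i \<subseteq> verts G" if "i \<in> {1..q}" for i using V(1) that by (auto simp: balanced_partitions_def)
  have "V' \<in> balanced_partitions q a H"
    unfolding balanced_partitions_def
  proof (intro CollectI conjI ballI)
    show "V' \<in> {1..q} \<rightarrow>\<^sub>E Pow (verts H)" using sub im unfolding V'_def by fastforce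
    show "V' i \<noteq> {}" if "i \<in> {1..q}" for i using V(1) that by (auto simp: V'_def balanced_partitions_def)
    show "disjoint_family_on V' {1..q}"
    proof (unfold disjoint_family_on_def, intro ballI impI)
      fix i j assume ij: "i \<in> {1..q}" "j \<in> {1..q}" "i \<noteq> j"
      then have "V i \<inter> V j = {}" using V(1) by (auto simp: balanced_partitions_def disjoint_family_on_def)
      then have "p ` V i \<inter> p ` V j = {}"
        using inj_on_image_Int[OF inj sub[OF ij(1)] sub[OF ij(2)]] by simp
      then show "V' i \<inter> V' j = {}" using ij by (simp add: V'_def)
    qed
    have "(\<Union>i\<in>{1..q}. V' i) = p ` (\<Union>i\<in>{1..q}. V i)" by (auto simp: V'_def)
    then show "(\<Union>i\<in>{1..q}. V' i) = verts H" using V(1) im by (simp add: balanced_partitions_def)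
    show "\<bar>weight H (V' i) / total_weight H - a i\<bar> \<le> max_weight H / total_weight H" if "i \<in> {1..q}" for i
      using V(1) that w[OF sub[OF that]] by (auto simp: V'_def balanced_partitions_def tot mx)
  qed
  moreover have "weighted_cut_density q H V' = z"
    unfolding V(2) weighted_cut_density_def
    by (intro sum.cong refl) (simp add: V'_def w sub em)
  ultimately show "z \<in> weighted_cut_density q H ` balanced_partitions q a H" by blast
qed

lemma isomorphism_invariant_min_cut_density: "isomorphism_invariant (min_cut_density q a)"
  unfolding isomorphism_invariant_def
proof (intro ballI impI)
  fix G H assume iso: "isomorphic G H"
  have eq: "weighted_cut_density q G ` balanced_partitions q a G = weighted_cut_density q H ` balanced_partitions q a H"
    by (rule equalityI[OF isomorphic_cut_densities[OF iso] isomorphic_cut_densities[OF isomorphic_sym[OF iso]]])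
  then have "balanced_partitions q a G = {} \<longleftrightarrow> balanced_partitions q a H = {}" by (metis image_is_empty)
  then show "min_cut_density q a G = min_cut_density q a H" using eq by (simp add: min_cut_density_def)
qed

section \<open>Cut densities in terms of normalised weights and class maps\<close>

lemma weight_eq_vprob:
  assumes "G \<in> weighted_graphs"
  shows "weight G S = total_weight G * sum (vprob G) S"
proof -
  have "sum (vprob G) S = weight G S / total_weight G"
    unfolding vprob_def weight_def by (rule sum_divide_distrib[symmetric])
  then show ?thesis using total_weight_pos[OF assms] by simp
qed

lemma edge_mass_eq_cut_sum:
  assumes "G \<in> weighted_graphs"
  shows "edge_mass G S T = (total_weight G)\<^sup>2 * cut_sum (vprob G) (eweight G) S T"
proof -
  have "(total_weight G)\<^sup>2 * (vprob G s * vprob G t * eweight G s t) = vweight G s * vweight G t * eweight G s t" for s t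
    using total_weight_pos[OF assms] unfolding vprob_def power2_eq_square by simp
  then show ?thesis unfolding edge_mass_def cut_sum_def sum_distrib_left by (simp only:)
qed

text \<open>Numerator and denominator both carry the square of the total weight, which
  cancels.\<close>

lemma weighted_cut_density_eq:
  assumes G: "G \<in> weighted_graphs" and V: "\<And>i. i \<in> {1..q} \<Longrightarrow> V i = {v\<in>verts G. f v = i}"
  shows "weighted_cut_density q G V = cut_density q (verts G) (vprob G) (eweight G) f"
  unfolding weighted_cut_density_def cut_density_def
proof (intro sum.cong refl)
  fix i j assume "i \<in> {1..q - 1}" "j \<in> {i + 1..q}"
  then have ij: "V i = {v\<in>verts G. f v = i}" "V j = {v\<in>verts G. f v = j}" using V by auto
  show "1 / (weight G (V i) * weight G (V j)) * edge_mass G (V i) (V j) =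
    cut_sum (vprob G) (eweight G) {v\<in>verts G. f v = i} {v\<in>verts G. f v = j} /
     (sum (vprob G) {v\<in>verts G. f v = i} * sum (vprob G) {v\<in>verts G. f v = j})"
    unfolding ij weight_eq_vprob[OF G] edge_mass_eq_cut_sum[OF G]
    using total_weight_pos[OF G] by (simp add: power2_eq_square)
qed

lemma balanced_partition_of_map:
  assumes G: "G \<in> weighted_graphs" and f: "\<forall>v\<in>verts G. f v \<in> {1..q}"
    and bal: "\<forall>i\<in>{1..q}. \<bar>sum (vprob G) {v\<in>verts G. f v = i} - a i\<bar> \<le> max_weight G / total_weight G"
    and a: "\<And>i. i \<in> {1..q} \<Longrightarrow> max_weight G / total_weight G < a i"
  obtains V where "V \<in> balanced_partitions q a G"
    "weighted_cut_density q G V = cut_density q (verts G) (vprob G) (eweight G) f"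
proof -
  define V where "V = (\<lambda>i\<in>{1..q}. {v\<in>verts G. f v = i})"
  have "V \<in> balanced_partitions q a G"
    unfolding balanced_partitions_def
  proof (intro CollectI conjI ballI)
    \<comment> \<open>An empty class would miss its target by \<open>a i\<close>, which is more than
      the tolerance.\<close>
    show "V i \<noteq> {}" if "i \<in> {1..q}" for i
    proof
      assume "V i = {}"
      then have "{v\<in>verts G. f v = i} = {}" using that by (simp add: V_def)
      then have "sum (vprob G) {v\<in>verts G. f v = i} = 0" by (simp only: sum.empty)
      then show False using bal[rule_format, OF that] a[OF that] by linarith
    qed
    show "\<bar>weight G (V i) / total_weight G - a i\<bar> \<le> max_weight G / total_weight G" if "i \<in> {1..q}" for i
    proof -
      have "weight G (V i) / total_weight G = sum (vprob G) {v\<in>verts G. f v = i}"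
        using that total_weight_pos[OF G] by (simp add: V_def weight_eq_vprob[OF G])
      then show ?thesis using bal that by simp
    qed
  qed (use f in \<open>auto simp: V_def disjoint_family_on_def\<close>)
  moreover have "weighted_cut_density q G V = cut_density q (verts G) (vprob G) (eweight G) f"
    by (rule weighted_cut_density_eq[OF G]) (simp add: V_def)
  ultimately show thesis using that by blast
qed

lemma map_of_balanced_partition:
  assumes G: "G \<in> weighted_graphs" and V: "V \<in> balanced_partitions q a G"
  obtains f where "\<forall>v\<in>verts G. f v \<in> {1..q}"
    "\<forall>i\<in>{1..q}. \<bar>sum (vprob G) {v\<in>verts G. f v = i} - a i\<bar> \<le> max_weight G / total_weight G"
    "weighted_cut_density q G V = cut_density q (verts G) (vprob G) (eweight G) f"
proof -
  have "\<forall>v\<in>verts G. \<exists>i\<in>{1..q}. v \<in> V i" using V by (auto simp: balanced_partitions_def)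
  then obtain f where f: "\<And>v. v \<in> verts G \<Longrightarrow> f v \<in> {1..q}" "\<And>v. v \<in> verts G \<Longrightarrow> v \<in> V (f v)" by metis
  have eq: "V i = {v\<in>verts G. f v = i}" if i: "i \<in> {1..q}" for i
  proof (intro equalityI subsetI CollectI conjI)
    fix v assume v: "v \<in> V i"
    show vG: "v \<in> verts G" using V i v by (auto simp: balanced_partitions_def)
    show "f v = i"
    proof (rule ccontr)
      assume "f v \<noteq> i"
      then have "V (f v) \<inter> V i = {}" using V f(1)[OF vG] i by (auto simp: balanced_partitions_def disjoint_family_on_def)
      then show False using f(2)[OF vG] v by auto
    qed
  qed (use f in auto)
  show thesis
  proof (rule that[OF _ ballI])
    show "\<forall>v\<in>verts G. f v \<in> {1..q}" using f(1) by blast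
    fix i assume i: "i \<in> {1..q}"
    have "\<bar>weight G (V i) / total_weight G - a i\<bar> \<le> max_weight G / total_weight G"
      using V i by (simp add: balanced_partitions_def)
    then show "\<bar>sum (vprob G) {v\<in>verts G. f v = i} - a i\<bar> \<le> max_weight G / total_weight G"
      unfolding eq[OF i] weight_eq_vprob[OF G] using total_weight_pos[OF G] by simp
  next
    show "weighted_cut_density q G V = cut_density q (verts G) (vprob G) (eweight G) f"
      by (rule weighted_cut_density_eq[OF G eq])
  qed
qed

lemma vprob_le_max: "G \<in> weighted_graphs \<Longrightarrow> v \<in> verts G \<Longrightarrow> vprob G v \<le> max_weight G / total_weight G"
  using total_weight_pos[of G] unfolding vprob_def max_weight_def
  by (intro divide_right_mono Max_ge) (auto simp: finite_verts)

lemma max_ratio_nonneg: "G \<in> weighted_graphs \<Longrightarrow> 0 \<le> max_weight G / total_weight G"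
proof -
  assume G: "G \<in> weighted_graphs"
  have "1 \<in> verts G" using G by (simp add: weighted_graphs_def verts_def)
  moreover have "0 < vprob G 1" using prob_weights_vprob[OF G] calculation by (auto simp: prob_weights_def)
  ultimately show ?thesis using vprob_le_max[OF G, of 1] by linarith
qed

text \<open>\<open>interval_rounding\<close> meets the targets \<open>a\<close> up to the largest
  normalised vertex weight, which is exactly the tolerance in
  \<open>balanced_partitions\<close>.\<close>

lemma balanced_partitions_nonempty:
  assumes G: "G \<in> weighted_graphs" and q: "q \<ge> 1" and a: "(\<Sum>i=1..q. a i) = 1"
    and small: "\<And>i. i \<in> {1..q} \<Longrightarrow> max_weight G / total_weight G < a i"
  shows "balanced_partitions q a G \<noteq> {}"
proof -
  have V: "finite (verts G)" "\<And>v. v \<in> verts G \<Longrightarrow> 0 < vprob G v" "(\<Sum>i=1..q. a i) = sum (vprob G) (verts G)"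
    using prob_weights_vprob[OF G] a by (auto simp: prob_weights_def)
  have a0: "0 \<le> a i" if "i \<in> {1..q}" for i using small[OF that] max_ratio_nonneg[OF G] by linarith
  have one: "1 \<in> {1..q}" using q by simp
  obtain f where f: "\<forall>v\<in>verts G. f v \<in> {1..q}"
    "\<forall>i\<in>{1..q}. \<bar>sum (vprob G) {v\<in>verts G. f v = i} - a i\<bar> \<le> max_weight G / total_weight G"
    by (rule interval_rounding[where g = "\<lambda>_. 1" and b = a and q = q,
        OF V(1,2) vprob_le_max[OF G] max_ratio_nonneg[OF G] one a0 V(3)])
  show ?thesis by (rule balanced_partition_of_map[OF G f small]) auto
qed

text \<open>An optimal partition of \<open>G1\<close> is transferred to \<open>G2\<close>, where it
  competes for the minimum. The hypotheses treat the two graphs alike, so exchanging them gives the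
  reverse inequality.\<close>

lemma min_cut_density_le:
  fixes a :: "nat \<Rightarrow> real" and \<tau>1 \<tau>2 :: "nat \<Rightarrow> nat" and M q :: nat and \<rho> \<delta> D :: real
  assumes G1: "G1 \<in> weighted_graphs" and G2: "G2 \<in> weighted_graphs"
    and r1: "max_weight G1 / total_weight G1 \<le> \<rho>" and r2: "max_weight G2 / total_weight G2 \<le> \<rho>"
    and t1: "\<And>v. v \<in> verts G1 \<Longrightarrow> \<tau>1 v < M" and t2: "\<And>v. v \<in> verts G2 \<Longrightarrow> \<tau>2 v < M"
    and close: "\<And>t. t < M \<Longrightarrow> \<bar>sum (vprob G1) {v\<in>verts G1. \<tau>1 v = t} - sum (vprob G2) {v\<in>verts G2. \<tau>2 v = t}\<bar> \<le> \<delta>"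
    and a: "(\<Sum>i=1..q. a i) = 1" and q: "q \<ge> 1"
    and c: "0 < c" "\<And>i. i \<in> {1..q} \<Longrightarrow> c + \<rho> \<le> a i"
    and \<kappa>: "\<And>s t. 0 \<le> \<kappa> s t \<and> \<kappa> s t \<le> 1" and \<theta>: "0 \<le> \<theta>"
    and c1: "c4 (verts G1) (vprob G1) (\<lambda>x y. eweight G1 x y - \<kappa> (\<tau>1 x) (\<tau>1 y)) \<le> \<theta> ^ 4"
    and c2: "c4 (verts G2) (vprob G2) (\<lambda>x y. eweight G2 x y - \<kappa> (\<tau>2 x) (\<tau>2 y)) \<le> \<theta> ^ 4"
    and D: "\<rho> + \<delta> + q * (q * (M * (\<rho> + \<delta>) + \<rho>) + \<rho>) \<le> D"
  shows "the (min_cut_density q a G2) \<le> the (min_cut_density q a G1) + q * (q * ((2 * \<theta> + 2 * M\<^sup>2 * D + 4 * \<rho>) / c\<^sup>2))"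
proof -
  let ?b = "balanced_partitions q a" and ?w = "weighted_cut_density q"
  have lt: "max_weight G / total_weight G < a i" if "max_weight G / total_weight G \<le> \<rho>" "i \<in> {1..q}" for G i
    using that c(1) c(2)[OF that(2)] by linarith
  have ne: "?b G1 \<noteq> {}" "?b G2 \<noteq> {}"
    using balanced_partitions_nonempty[OF G1 q a lt[OF r1]] balanced_partitions_nonempty[OF G2 q a lt[OF r2]] by auto
  have mcd: "the (min_cut_density q a G) = Min (?w G ` ?b G)" if "?b G \<noteq> {}" for G
    using that by (simp add: min_cut_density_def)
  have "Min (?w G1 ` ?b G1) \<in> ?w G1 ` ?b G1" using ne finite_balanced_partitions by (intro Min_in) auto
  then obtain V where V: "V \<in> ?b G1" "Min (?w G1 ` ?b G1) = ?w G1 V" by auto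
  obtain f where f: "\<forall>v\<in>verts G1. f v \<in> {1..q}"
    "\<forall>i\<in>{1..q}. \<bar>sum (vprob G1) {v\<in>verts G1. f v = i} - a i\<bar> \<le> max_weight G1 / total_weight G1"
    "?w G1 V = cut_density q (verts G1) (vprob G1) (eweight G1) f"
    by (rule map_of_balanced_partition[OF G1 V(1)])
  \<comment> \<open>Fourth roots turn the 4-cycle bounds into cut bounds valid for all pairs of
    vertex sets.\<close>
  have cut: "\<bar>cut_sum p U S T\<bar> \<le> \<theta>" if "prob_weights X p" "c4 X p U \<le> \<theta> ^ 4" "S \<subseteq> X" "T \<subseteq> X" for X p U S T
  proof -
    have "\<bar>cut_sum p U S T\<bar> ^ 4 \<le> \<theta> ^ 4"
      using order_trans[OF cut_sum_le_c4[OF that(1,3,4)] that(2)] by (simp add: power_even_abs)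
    then show ?thesis using \<theta> by (subst (asm) power_mono_iff) auto
  qed
  have W1: "0 \<le> eweight G1 x y \<and> eweight G1 x y \<le> 1" if "x \<in> verts G1" "y \<in> verts G1" for x y
    using G1 that by (auto simp: weighted_graphs_def)
  have a0: "0 \<le> a i" if "i \<in> {1..q}" for i using lt[OF r1 that] max_ratio_nonneg[OF G1] by linarith
  obtain f2 where f2: "\<forall>v\<in>verts G2. f2 v \<in> {1..q}"
    "\<forall>i\<in>{1..q}. \<bar>sum (vprob G2) {v\<in>verts G2. f2 v = i} - a i\<bar> \<le> max_weight G2 / total_weight G2"
    "cut_density q (verts G2) (vprob G2) (eweight G2) f2 \<le> cut_density q (verts G1) (vprob G1) (eweight G1) f
       + q * (q * ((2 * \<theta> + 2 * M\<^sup>2 * D + 4 * \<rho>) / c\<^sup>2))"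
    by (rule cut_density_transfer[OF prob_weights_vprob[OF G1] prob_weights_vprob[OF G2] vprob_le_max[OF G2] max_ratio_nonneg[OF G2] r2
      t1 t2 close f(1)[rule_format] order_trans[OF f(2)[rule_format] r1] a0 a q c W1 \<kappa>
      cut[OF prob_weights_vprob[OF G1] c1] cut[OF prob_weights_vprob[OF G2] c2] D])
  obtain V2 where V2: "V2 \<in> ?b G2" "?w G2 V2 = cut_density q (verts G2) (vprob G2) (eweight G2) f2"
    by (rule balanced_partition_of_map[OF G2 f2(1,2) lt[OF r2]])
  have "Min (?w G2 ` ?b G2) \<le> ?w G2 V2" using V2(1) finite_balanced_partitions by (intro Min_le) auto
  then show ?thesis using V2(2) f2(3) f(3) V(2) mcd[OF ne(1)] mcd[OF ne(2)] by linarith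
qed

lemma vprob_simple_graph: "vprob (simple_graph k E) = (\<lambda>_. 1 / real k)"
  by (simp add: fun_eq_iff vprob_def simple_graph_def total_weight_def weight_def verts_def)

lemma verts_simple_graph: "verts (simple_graph k E) = {1..k}"
  by (simp add: simple_graph_def verts_def)

theorem proposition17:
  fixes q :: nat and a :: "nat \<Rightarrow> real"
  assumes "q \<ge> 1"
    and "\<forall>i\<in>{1..q}. a i > 0"
    and "(\<Sum>i=1..q. a i) = 1"
  shows "testable (min_cut_density q a)"
  unfolding testable_def
proof (intro conjI allI impI isomorphism_invariant_min_cut_density)
  fix \<epsilon> :: real assume \<epsilon>: "0 < \<epsilon>"
  note q = assms(1) and a1 = assms(3)
  \<comment> \<open>One half of the smallest \<open>a i\<close> bounds the class weights from below,
    the other half absorbs the tolerance \<open>1 / k\<close>.\<close>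
  define c where "c = Min (a ` {1..q}) / 2"
  have "Min (a ` {1..q}) \<in> a ` {1..q}" using q by (intro Min_in) auto
  then have c: "0 < c" using assms(2) by (auto simp: c_def)
  have ca: "c + c \<le> a i" if "i \<in> {1..q}" for i
    using Min_le[of "a ` {1..q}" "a i"] that by (simp add: c_def)
  \<comment> \<open>Makes the contribution \<open>q * q * 2 * \<theta> / c\<^sup>2\<close> of the
    cut errors equal to \<open>\<epsilon> / 2\<close>.\<close>
  define \<theta> where "\<theta> = \<epsilon> * c\<^sup>2 / (4 * (q * q))"
  have \<theta>: "0 < \<theta>" using \<epsilon> c q by (simp add: \<theta>_def)
  \<comment> \<open>The first bound makes \<open>G\<close> itself close enough to the step kernel;
    the second keeps its share of the Markov bound for the sample at most
    \<open>\<epsilon> / 4\<close>.\<close>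
  define \<eta> where "\<eta> = min (\<theta> ^ 4) (\<theta> ^ 4 * (\<epsilon> / 4))"
  have \<eta>: "0 < \<eta>" "\<eta> \<le> \<theta> ^ 4" "\<eta> / \<theta> ^ 4 \<le> \<epsilon> / 4" using \<theta> \<epsilon> by (auto simp: \<eta>_def field_simps)
  obtain M :: nat where M: "\<forall>V p W. prob_weights V p \<longrightarrow> (\<forall>x\<in>V. \<forall>y\<in>V. 0 \<le> W x y \<and> W x y \<le> 1) \<longrightarrow>
    (\<exists>(\<tau> :: nat \<Rightarrow> nat) \<kappa>. (\<forall>v\<in>V. \<tau> v < M) \<and> (\<forall>s t. 0 \<le> \<kappa> s t \<and> \<kappa> s t \<le> 1) \<and>
      c4 V p (\<lambda>x y. W x y - \<kappa> (\<tau> x) (\<tau> y)) \<le> \<eta>)"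
    by (rule weak_regularity[OF \<eta>(1)])
  \<comment> \<open>With \<open>1 / k \<le> \<delta>\<close>, the profile error in
    \<open>transfer_partition\<close> is at most \<open>C * \<delta>\<close>. \<open>X\<close> is
    the total coefficient of \<open>\<delta>\<close> in the final error, so
    \<open>\<delta> = \<epsilon> / (2 * X)\<close> uses up the other half of
    \<open>\<epsilon>\<close>.\<close>
  define C :: real where "C = 2 + q * (q * (2 * M + 1) + 1)"
  define X where "X = q * (q * ((2 * M\<^sup>2 * C + 4) / c\<^sup>2))"
  have C: "0 \<le> C" by (simp add: C_def)
  have X: "0 < X" using C c q unfolding X_def by (intro mult_pos_pos divide_pos_pos add_nonneg_pos mult_nonneg_nonneg) auto
  define \<delta> where "\<delta> = \<epsilon> / (2 * X)"
  have \<delta>: "0 < \<delta>" using \<epsilon> X by (simp add: \<delta>_def)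
  have err: "q * (q * ((2 * \<theta> + 2 * M\<^sup>2 * (C * \<delta>) + 4 * \<rho>) / c\<^sup>2)) \<le> \<epsilon>" if "\<rho> \<le> \<delta>" for \<rho>
  proof -
    have "q * (q * ((2 * \<theta> + 2 * M\<^sup>2 * (C * \<delta>) + 4 * \<rho>) / c\<^sup>2)) \<le> q * (q * ((2 * \<theta> + 2 * M\<^sup>2 * (C * \<delta>) + 4 * \<delta>) / c\<^sup>2))"
      using that by (intro mult_left_mono divide_right_mono) auto
    also have "\<dots> = q * (q * (2 * \<theta> / c\<^sup>2)) + X * \<delta>"
      by (simp add: X_def algebra_simps add_divide_distrib)
    also have "q * (q * (2 * \<theta> / c\<^sup>2)) = \<epsilon> / 2" using c q by (simp add: \<theta>_def field_simps)
    also have "X * \<delta> = \<epsilon> / 2" using X by (simp add: \<delta>_def)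
    finally show ?thesis by simp
  qed
  \<comment> \<open>The summands secure, in turn, \<open>1 \<le> k\<close>,
    \<open>1 / k \<le> \<delta>\<close>, \<open>1 / k \<le> c\<close>, and a share of at most
    \<open>\<epsilon> / 4\<close> in the failure probability for each of the degenerate 4-cycles and
    the type counts.\<close>
  obtain k :: nat where k: "1 + 1 / \<delta> + 1 / c + 24 / (\<epsilon> * \<theta> ^ 4) + 4 * M / (\<epsilon> * \<delta>\<^sup>2) \<le> real k"
    using real_arch_simple by blast
  have nn: "0 \<le> 1 / \<delta>" "0 \<le> 1 / c" "0 \<le> 24 / (\<epsilon> * \<theta> ^ 4)" "0 \<le> 4 * M / (\<epsilon> * \<delta>\<^sup>2)"
    using \<delta> c \<epsilon> \<theta> by auto
  have kk: "1 \<le> real k" "1 / \<delta> \<le> k" "1 / c \<le> k" "24 / (\<epsilon> * \<theta> ^ 4) \<le> k" "4 * M / (\<epsilon> * \<delta>\<^sup>2) \<le> k"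
    using k nn by linarith+
  have k1: "k \<ge> 1" using kk(1) by simp
  have k\<delta>: "1 / real k \<le> \<delta>" using kk(2) \<delta> k1 by (simp add: field_simps)
  have kc: "1 / real k \<le> c" using kk(3) c k1 by (simp add: field_simps)
  have k6: "6 / k / \<theta> ^ 4 \<le> \<epsilon> / 4" using kk(4) \<epsilon> \<theta> k1 by (simp add: field_simps)
  have kM: "M / (k * \<delta>\<^sup>2) \<le> \<epsilon> / 4" using kk(5) \<epsilon> \<delta> k1 by (simp add: field_simps)
  have ck: "c + 1 / real k \<le> a i" if "i \<in> {1..q}" for i using ca[OF that] kc by linarith
  have D: "1 / real k + \<delta> + q * (q * (M * (1 / real k + \<delta>) + 1 / real k) + 1 / real k) \<le> C * \<delta>"
  proof -
    have "1 / real k + \<delta> + q * (q * (M * (1 / real k + \<delta>) + 1 / real k) + 1 / real k)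
       \<le> \<delta> + \<delta> + q * (q * (M * (\<delta> + \<delta>) + \<delta>) + \<delta>)"
      using k\<delta> by (intro add_mono mult_left_mono) auto
    also have "\<dots> = C * \<delta>" by (simp add: C_def algebra_simps)
    finally show ?thesis .
  qed
  show "\<exists>k\<ge>1. \<forall>G\<in>weighted_graphs. max_weight G / total_weight G \<le> 1 / real k \<longrightarrow>
        min_cut_density q a G \<noteq> None \<and>
        measure_pmf.prob (sample k G) {H. \<bar>the (min_cut_density q a G) - the (min_cut_density q a H)\<bar> > \<epsilon>} \<le> \<epsilon>"
  proof (intro exI[of _ k] conjI ballI impI k1)
    fix G assume G: "G \<in> weighted_graphs" and ratio: "max_weight G / total_weight G \<le> 1 / real k"
    have "max_weight G / total_weight G < a i" if "i \<in> {1..q}" for i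
      using ratio ck[OF that] c by linarith
    then show "min_cut_density q a G \<noteq> None"
      using balanced_partitions_nonempty[OF G q a1] by (simp add: min_cut_density_def)
    have "\<forall>x\<in>verts G. \<forall>y\<in>verts G. 0 \<le> eweight G x y \<and> eweight G x y \<le> 1"
      using G by (auto simp: weighted_graphs_def)
    then obtain \<tau> :: "nat \<Rightarrow> nat" and \<kappa> where regular: "\<forall>v\<in>verts G. \<tau> v < M" "\<forall>s t. 0 \<le> \<kappa> s t \<and> \<kappa> s t \<le> 1"
      and c4: "c4 (verts G) (vprob G) (\<lambda>x y. eweight G x y - \<kappa> (\<tau> x) (\<tau> y)) \<le> \<eta>"
      using M prob_weights_vprob[OF G] by blast
    have \<tau>: "\<tau> v < M" if "v \<in> verts G" for v using regular(1) that by blast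
    have \<kappa>: "0 \<le> \<kappa> s t \<and> \<kappa> s t \<le> 1" for s t using regular(2) by blast
    have "measure_pmf.prob (sample k G) {H. \<bar>the (min_cut_density q a G) - the (min_cut_density q a H)\<bar> > \<epsilon>}
      \<le> (c4 (verts G) (vprob G) (\<lambda>x y. eweight G x y - \<kappa> (\<tau> x) (\<tau> y)) + 6 / k) / \<theta> ^ 4 + M / (k * \<delta>\<^sup>2)"
    proof (rule sample_regular[OF G k1 \<kappa> \<theta> \<delta>])
      fix \<Phi> E
      assume \<Phi>: "\<And>u. u \<in> {1..k} \<Longrightarrow> \<Phi> u \<in> verts G"
        and c4H: "c4 {1..k} (\<lambda>_. 1 / real k) (\<lambda>u v. eweight (simple_graph k E) u v - \<kappa> (\<tau> (\<Phi> u)) (\<tau> (\<Phi> v))) \<le> \<theta> ^ 4"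
        and types: "\<And>t. t < M \<Longrightarrow> \<bar>sum (\<lambda>_. 1 / real k) {u\<in>{1..k}. \<tau> (\<Phi> u) = t} - sum (vprob G) {v\<in>verts G. \<tau> v = t}\<bar> \<le> \<delta>"
      define H where "H = simple_graph k E"
      have H: "H \<in> weighted_graphs" unfolding H_def by (rule simple_graph_in_weighted_graphs[OF k1])
      have ratioH: "max_weight H / total_weight H \<le> 1 / real k"
        unfolding H_def using max_weight_ratio_simple_graph[OF k1] by simp
      \<comment> \<open>A sample vertex \<open>u\<close> gets the type of \<open>\<Phi> u\<close>,
        so both graphs are compared with the same \<open>\<kappa>\<close>.\<close>
      have \<tau>H: "\<tau> (\<Phi> u) < M" if "u \<in> verts H" for u
        using \<tau> \<Phi> that by (simp add: H_def verts_simple_graph)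
      have c4H': "c4 (verts H) (vprob H) (\<lambda>u v. eweight H u v - \<kappa> (\<tau> (\<Phi> u)) (\<tau> (\<Phi> v))) \<le> \<theta> ^ 4"
        using c4H by (simp add: H_def verts_simple_graph vprob_simple_graph)
      have typesH: "\<bar>sum (vprob H) {u\<in>verts H. \<tau> (\<Phi> u) = t} - sum (vprob G) {v\<in>verts G. \<tau> v = t}\<bar> \<le> \<delta>" if "t < M" for t
        using types[OF that] by (simp add: H_def verts_simple_graph vprob_simple_graph)
      have typesG: "\<bar>sum (vprob G) {v\<in>verts G. \<tau> v = t} - sum (vprob H) {u\<in>verts H. \<tau> (\<Phi> u) = t}\<bar> \<le> \<delta>" if "t < M" for t
        using typesH[OF that] by (simp add: abs_minus_commute)
      note c4G = order_trans[OF c4 \<eta>(2)]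
      have "the (min_cut_density q a H) \<le> the (min_cut_density q a G) + \<epsilon>"
        using min_cut_density_le[OF G H ratio ratioH \<tau> \<tau>H typesG a1 q c ck \<kappa> less_imp_le[OF \<theta>] c4G c4H' D] err[OF k\<delta>] by linarith
      moreover have "the (min_cut_density q a G) \<le> the (min_cut_density q a H) + \<epsilon>"
        using min_cut_density_le[OF H G ratioH ratio \<tau>H \<tau> typesH a1 q c ck \<kappa> less_imp_le[OF \<theta>] c4H' c4G D] err[OF k\<delta>] by linarith
      ultimately show "simple_graph k E \<notin> {H. \<bar>the (min_cut_density q a G) - the (min_cut_density q a H)\<bar> > \<epsilon>}"
        by (simp add: H_def abs_le_iff)
    qed
    also have "\<dots> \<le> (\<eta> + 6 / k) / \<theta> ^ 4 + M / (k * \<delta>\<^sup>2)"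
      using c4 \<theta> by (intro add_mono divide_right_mono) auto
    also have "\<dots> = \<eta> / \<theta> ^ 4 + 6 / k / \<theta> ^ 4 + M / (k * \<delta>\<^sup>2)" by (simp add: add_divide_distrib)
    also have "\<dots> \<le> \<epsilon>" using \<eta>(3) k6 kM \<epsilon> by linarith
    finally show "measure_pmf.prob (sample k G) {H. \<bar>the (min_cut_density q a G) - the (min_cut_density q a H)\<bar> > \<epsilon>} \<le> \<epsilon>" .
  qed
qed

end
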